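(* Let $R^W$ be the curvature tensor of $(\mathcal{P}_+(G),g_W)$. For $\rho\in\mathcal{P}_+(G)$ and $\sigma_1,\sigma_2,\sigma_3,\sigma_4\in T_\rho\mathcal{P}_+(G)$, $$\begin{aligned}g_W(R^W(\sigma_1,\sigma_2)\sigma_3,\sigma_4)=\frac14\Big\{&\sigma_2^{\mathsf T}L(\rho)^\dagger L(m(\sigma_1,\sigma_3))L(\rho)^\dagger\sigma_4+\sigma_1^{\mathsf T}L(\rho)^\dagger L(m(\sigma_2,\sigma_4))L(\rho)^\dagger\sigma_3\\&-\sigma_2^{\mathsf T}L(\rho)^\dagger L(m(\sigma_1,\sigma_4))L(\rho)^\dagger\sigma_3-\sigma_1^{\mathsf T}L(\rho)^\dagger L(m(\sigma_2,\sigma_3))L(\rho)^\dagger\sigma_4\\&+2n(\sigma_1,\sigma_2)^{\mathsf T}L(\rho)^\dagger n(\sigma_3,\sigma_4)+n(\sigma_1,\sigma_3)^{\mathsf T}L(\rho)^\dagger n(\sigma_2,\sigma_4)\\&-n(\sigma_2,\sigma_3)^{\mathsf T}L(\rho)^\dagger n(\sigma_1,\sigma_4)\Big\},\end{aligned}$$ where $m,n:T_\rho\mathcal{P}_+(G)\times T_\rho\mathcal{P}_+(G)\to T_\rho\mathcal{P}_+(G)$ are the symmetric, respectively antisymmetric, operators $$m(\sigma_a,\sigma_b):=-\big[L(\sigma_a)L(\rho)^\dagger\sigma_b+L(\sigma_b)L(\rho)^\dagger\sigma_a\big]+\frac12L(\rho)\big(\nabla_GL(\rho)^\dagger\sigma_a\circ\nabla_GL(\rho)^\dagger\sigma_b\big),$$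 $$n(\sigma_a,\sigma_b):=L(\sigma_a)L(\rho)^\dagger\sigma_b-L(\sigma_b)L(\rho)^\dagger\sigma_a.$$
   Context: $G=(V,E,\omega)$ is a connected, weighted, undirected finite graph with vertex set $V=\{1,\dots,n\}$, edge set $E$ and weights $\omega_{ij}=\omega_{ji}>0$ if $(i,j)\in E$, $\omega_{ij}=0$ otherwise; $N(i)=\{j:(i,j)\in E\}$. For $\Phi\in\mathbb{R}^n$, $\nabla_G\Phi=(\nabla_{ij}\Phi)$ with $\nabla_{ij}\Phi=\sqrt{\omega_{ij}}(\Phi(i)-\Phi(j))$; for edge fields $v,\tilde v$, $v\circ\tilde v=\frac12\big(\sum_{j\in N(i)}v_{ij}\tilde v_{ij}\big)_{i=1}^n\in\mathbb{R}^n$. For $a\in\mathbb{R}^n$ put $\theta_{ij}(a)=\frac{a_i+a_j}{2}$; the linear weighted Laplacian matrix $L(a)\in\mathbb{R}^{n\times n}$ is given by $(L(a)\Phi)(i)=\sum_{j\in N(i)}\omega_{ij}\theta_{ij}(a)(\Phi(i)-\Phi(j))$. $A^\dagger$ is the Moore-Penrose pseudo-inverse. $\mathcal{P}_+(G)=\{\rho\in\mathbb{R}^n:\sum_i\rho_i=1,\ \rho_i>0\}$, with tangent space $T_\rho\mathcal{P}_+(G)=\{\sigma\in\mathbb{R}^n:\sum_i\sigma_i=0\}$, carries the Riemannian metric $g_W(\sigma_1,\sigma_2)=\sigma_1^{\mathsf T}L(\rho)^\dagger\sigma_2$, with Levi-Civita connection $\nabla^W$. Curvature convention: $R^W(\sigma_1,\sigma_2)\sigma_3=\nabla^W_{\sigma_1}\nabla^W_{\sigma_2}\sigma_3-\nabla^W_{\sigma_2}\nabla^W_{\sigma_1}\sigma_3-\nabla^W_{[\sigma_1,\sigma_2]}\sigma_3$.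 *)

theory Defs
  imports "HOL-Analysis.Analysis"
begin

subsection \<open>Weighted graphs\<close>

text \<open>The vertex set is the whole finite index type, so that functions on the vertices
  are vectors \<open>real ^ 'n\<close>.  Loops are not excluded; they contribute nothing below.\<close>

definition connected_weighted_graph ::
  "('n::finite \<times> 'n) set \<Rightarrow> ('n \<Rightarrow> 'n \<Rightarrow> real) \<Rightarrow> bool" where
  "connected_weighted_graph E \<omega> \<longleftrightarrow>
     sym E \<and>
     (\<forall>i j. \<omega> i j = \<omega> j i) \<and>
     (\<forall>i j. (i, j) \<in> E \<longrightarrow> \<omega> i j > 0) \<and>
     (\<forall>i j. (i, j) \<notin> E \<longrightarrow> \<omega> i j = 0) \<and>
     (\<forall>i j. (i, j) \<in> E\<^sup>*)"

definition nbrs :: "('n::finite \<times> 'n) set \<Rightarrow> 'n \<Rightarrow> 'n set" where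
  "nbrs E i = {j. (i, j) \<in> E}"

definition grad :: "('n::finite \<Rightarrow> 'n \<Rightarrow> real) \<Rightarrow> real ^ 'n \<Rightarrow> 'n \<Rightarrow> 'n \<Rightarrow> real" where
  "grad \<omega> \<Phi> i j = sqrt (\<omega> i j) * (\<Phi> $ i - \<Phi> $ j)"

definition edge_prod :: "('n::finite \<times> 'n) set \<Rightarrow>
    ('n \<Rightarrow> 'n \<Rightarrow> real) \<Rightarrow> ('n \<Rightarrow> 'n \<Rightarrow> real) \<Rightarrow> real ^ 'n" where
  "edge_prod E v w = (\<chi> i. 1 / 2 * (\<Sum>j\<in>nbrs E i. v i j * w i j))"

definition theta :: "real ^ 'n \<Rightarrow> 'n::finite \<Rightarrow> 'n \<Rightarrow> real" where
  "theta a i j = (a $ i + a $ j) / 2"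

definition laplacian :: "('n::finite \<times> 'n) set \<Rightarrow> ('n \<Rightarrow> 'n \<Rightarrow> real) \<Rightarrow>
    real ^ 'n \<Rightarrow> real ^ 'n ^ 'n" where
  "laplacian E \<omega> a =
     matrix (\<lambda>\<Phi>. \<chi> i. \<Sum>j\<in>nbrs E i. \<omega> i j * theta a i j * (\<Phi> $ i - \<Phi> $ j))"

lemma laplacian_mult_vec:
  "(laplacian E \<omega> a *v \<Phi>) $ i =
     (\<Sum>j\<in>nbrs E i. \<omega> i j * theta a i j * (\<Phi> $ i - \<Phi> $ j))"
proof -
  have "linear (\<lambda>\<Phi> :: real ^ 'a. \<chi> i. \<Sum>j\<in>nbrs E i. \<omega> i j * theta a i j * (\<Phi> $ i - \<Phi> $ j))"
    by (rule linearI)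
       (auto simp: vec_eq_iff algebra_simps sum.distrib sum_subtractf sum_distrib_left)
  then show ?thesis
    by (simp add: laplacian_def matrix_works)
qed


subsection \<open>The Moore--Penrose pseudo-inverse\<close>

definition is_pinv :: "real ^ 'n ^ 'm \<Rightarrow> real ^ 'm ^ 'n \<Rightarrow> bool" where
  "is_pinv A B \<longleftrightarrow>
     A ** B ** A = A \<and> B ** A ** B = B \<and>
     transpose (A ** B) = A ** B \<and> transpose (B ** A) = B ** A"

definition pinv :: "real ^ 'n ^ 'm \<Rightarrow> real ^ 'm ^ 'n" where
  "pinv A = (THE B. is_pinv A B)"

lemma is_pinv_unique:
  fixes A :: "real ^ 'n ^ 'm"
  assumes B: "is_pinv A B" and C: "is_pinv A C"
  shows "B = C"
proof -
  have AB: "A ** B = A ** C"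
  proof -
    have "A ** B = transpose (A ** B)" using B by (simp add: is_pinv_def)
    also have "\<dots> = transpose ((A ** C) ** (A ** B))"
      using C by (simp add: is_pinv_def matrix_mul_assoc)
    also have "\<dots> = (A ** B) ** (A ** C)"
      using B C by (simp add: is_pinv_def matrix_transpose_mul)
    also have "\<dots> = A ** C" using B by (simp add: is_pinv_def matrix_mul_assoc)
    finally show ?thesis .
  qed
  have BA: "B ** A = C ** A"
  proof -
    have "B ** A = transpose (B ** A)" using B by (simp add: is_pinv_def)
    also have "\<dots> = transpose ((B ** A) ** (C ** A))"
      using C by (metis is_pinv_def matrix_mul_assoc)
    also have "\<dots> = (C ** A) ** (B ** A)"
      using B C by (simp add: is_pinv_def matrix_transpose_mul)
    also have "\<dots> = C ** A" using B by (metis is_pinv_def matrix_mul_assoc)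
    finally show ?thesis .
  qed
  have "B = B ** (A ** B)" using B by (simp add: is_pinv_def matrix_mul_assoc)
  also have "\<dots> = C ** A ** C" by (simp add: AB matrix_mul_assoc BA)
  also have "\<dots> = C" using C by (simp add: is_pinv_def)
  finally show ?thesis .
qed

lemma pinv_eqI: "is_pinv A B \<Longrightarrow> pinv A = B"
  unfolding pinv_def by (blast intro: is_pinv_unique)


subsection \<open>The interior of the probability simplex as a manifold\<close>

text \<open>\<open>simplex_int\<close> is open in an affine hyperplane, so its tangent space is the same vector
  space \<open>tangent\<close> at every point.\<close>

definition simplex_int :: "(real ^ 'n) set" where
  "simplex_int = {\<rho>. (\<Sum>i\<in>UNIV. \<rho> $ i) = 1 \<and> (\<forall>i. \<rho> $ i > 0)}"

definition tangent :: "(real ^ 'n) set" where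
  "tangent = {\<sigma>. (\<Sum>i\<in>UNIV. \<sigma> $ i) = 0}"

text \<open>For \<open>\<rho> \<in> simplex_int\<close> and \<open>\<sigma> \<in> tangent\<close> the derivative below depends only on the
  values of \<open>f\<close> on \<open>simplex_int\<close>.\<close>

definition dir_deriv :: "(real ^ 'n \<Rightarrow> 'b::real_normed_vector) \<Rightarrow> real ^ 'n \<Rightarrow> real ^ 'n \<Rightarrow> 'b" where
  "dir_deriv f \<rho> \<sigma> = vector_derivative (\<lambda>t. f (\<rho> + t *\<^sub>R \<sigma>)) (at 0)"

text \<open>Class \<open>C\<^sup>k\<close> on \<open>simplex_int\<close>; functions are total, but their values elsewhere are
  irrelevant.\<close>

primrec Ck :: "nat \<Rightarrow> (real ^ 'n \<Rightarrow> 'b::real_normed_vector) \<Rightarrow> bool" where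
  "Ck 0 f \<longleftrightarrow> continuous_on simplex_int f"
| "Ck (Suc k) f \<longleftrightarrow>
     f differentiable_on simplex_int \<and> (\<forall>\<sigma>\<in>tangent. Ck k (\<lambda>\<rho>. dir_deriv f \<rho> \<sigma>))"

definition smooth :: "(real ^ 'n \<Rightarrow> 'b::real_normed_vector) \<Rightarrow> bool" where
  "smooth f \<longleftrightarrow> (\<forall>k. Ck k f)"

definition vector_fields :: "(real ^ 'n \<Rightarrow> real ^ 'n) set" where
  "vector_fields = {X. smooth X \<and> (\<forall>\<rho>\<in>simplex_int. X \<rho> \<in> tangent)}"

text \<open>In the global affine chart, \<open>[X, Y] = D\<^sub>X Y - D\<^sub>Y X\<close>.\<close>

definition lie_bracket ::
  "(real ^ 'n \<Rightarrow> real ^ 'n) \<Rightarrow> (real ^ 'n \<Rightarrow> real ^ 'n) \<Rightarrow> real ^ 'n \<Rightarrow> real ^ 'n" where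
  "lie_bracket X Y = (\<lambda>\<rho>. dir_deriv Y \<rho> (X \<rho>) - dir_deriv X \<rho> (Y \<rho>))"


subsection \<open>Levi-Civita connection and curvature\<close>

type_synonym 'n connection =
  "(real ^ 'n \<Rightarrow> real ^ 'n) \<Rightarrow> (real ^ 'n \<Rightarrow> real ^ 'n) \<Rightarrow> real ^ 'n \<Rightarrow> real ^ 'n"

definition affine_connection :: "'n::finite connection \<Rightarrow> bool" where
  "affine_connection D \<longleftrightarrow>
     (\<forall>X\<in>vector_fields. \<forall>Y\<in>vector_fields. D X Y \<in> vector_fields) \<and>
     (\<forall>X\<in>vector_fields. \<forall>X'\<in>vector_fields. \<forall>Y\<in>vector_fields. \<forall>\<rho>\<in>simplex_int.
        D (\<lambda>x. X x + X' x) Y \<rho> = D X Y \<rho> + D X' Y \<rho>) \<and>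
     (\<forall>f::real ^ 'n \<Rightarrow> real. smooth f \<longrightarrow>
       (\<forall>X\<in>vector_fields. \<forall>Y\<in>vector_fields. \<forall>\<rho>\<in>simplex_int.
        D (\<lambda>x. f x *\<^sub>R X x) Y \<rho> = f \<rho> *\<^sub>R D X Y \<rho>)) \<and>
     (\<forall>X\<in>vector_fields. \<forall>Y\<in>vector_fields. \<forall>Y'\<in>vector_fields. \<forall>\<rho>\<in>simplex_int.
        D X (\<lambda>x. Y x + Y' x) \<rho> = D X Y \<rho> + D X Y' \<rho>) \<and>
     (\<forall>f::real ^ 'n \<Rightarrow> real. smooth f \<longrightarrow>
       (\<forall>X\<in>vector_fields. \<forall>Y\<in>vector_fields. \<forall>\<rho>\<in>simplex_int.
        D X (\<lambda>x. f x *\<^sub>R Y x) \<rho> = f \<rho> *\<^sub>R D X Y \<rho> + dir_deriv f \<rho> (X \<rho>) *\<^sub>R Y \<rho>))"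

definition torsion_free :: "'n::finite connection \<Rightarrow> bool" where
  "torsion_free D \<longleftrightarrow>
     (\<forall>X\<in>vector_fields. \<forall>Y\<in>vector_fields. \<forall>\<rho>\<in>simplex_int.
        D X Y \<rho> - D Y X \<rho> = lie_bracket X Y \<rho>)"

definition metric_compatible ::
  "(real ^ 'n \<Rightarrow> real ^ 'n \<Rightarrow> real ^ 'n \<Rightarrow> real) \<Rightarrow> 'n::finite connection \<Rightarrow> bool" where
  "metric_compatible g D \<longleftrightarrow>
     (\<forall>X\<in>vector_fields. \<forall>Y\<in>vector_fields. \<forall>Z\<in>vector_fields. \<forall>\<rho>\<in>simplex_int.
        dir_deriv (\<lambda>x. g x (Y x) (Z x)) \<rho> (X \<rho>) =
        g \<rho> (D X Y \<rho>) (Z \<rho>) + g \<rho> (Y \<rho>) (D X Z \<rho>))"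

definition levi_civita ::
  "(real ^ 'n \<Rightarrow> real ^ 'n \<Rightarrow> real ^ 'n \<Rightarrow> real) \<Rightarrow> 'n::finite connection \<Rightarrow> bool" where
  "levi_civita g D \<longleftrightarrow> affine_connection D \<and> torsion_free D \<and> metric_compatible g D"

definition curvature :: "'n::finite connection \<Rightarrow> (real ^ 'n \<Rightarrow> real ^ 'n) \<Rightarrow> (real ^ 'n \<Rightarrow> real ^ 'n) \<Rightarrow>
    (real ^ 'n \<Rightarrow> real ^ 'n) \<Rightarrow> real ^ 'n \<Rightarrow> real ^ 'n" where
  "curvature D X Y Z = (\<lambda>\<rho>. D X (D Y Z) \<rho> - D Y (D X Z) \<rho> - D (lie_bracket X Y) Z \<rho>)"


subsection \<open>The Wasserstein metric and the operators in the curvature formula\<close>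

definition metric_W :: "('n::finite \<times> 'n) set \<Rightarrow> ('n \<Rightarrow> 'n \<Rightarrow> real) \<Rightarrow>
    real ^ 'n \<Rightarrow> real ^ 'n \<Rightarrow> real ^ 'n \<Rightarrow> real" where
  "metric_W E \<omega> \<rho> \<sigma>\<^sub>1 \<sigma>\<^sub>2 = \<sigma>\<^sub>1 \<bullet> (pinv (laplacian E \<omega> \<rho>) *v \<sigma>\<^sub>2)"

definition m_op :: "('n::finite \<times> 'n) set \<Rightarrow> ('n \<Rightarrow> 'n \<Rightarrow> real) \<Rightarrow>
    real ^ 'n \<Rightarrow> real ^ 'n \<Rightarrow> real ^ 'n \<Rightarrow> real ^ 'n" where
  "m_op E \<omega> \<rho> a b =
     - ((laplacian E \<omega> a ** pinv (laplacian E \<omega> \<rho>)) *v b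
        + (laplacian E \<omega> b ** pinv (laplacian E \<omega> \<rho>)) *v a)
     + (1 / 2) *\<^sub>R (laplacian E \<omega> \<rho> *v
         edge_prod E (grad \<omega> (pinv (laplacian E \<omega> \<rho>) *v a))
                     (grad \<omega> (pinv (laplacian E \<omega> \<rho>) *v b)))"

definition n_op :: "('n::finite \<times> 'n) set \<Rightarrow> ('n \<Rightarrow> 'n \<Rightarrow> real) \<Rightarrow>
    real ^ 'n \<Rightarrow> real ^ 'n \<Rightarrow> real ^ 'n \<Rightarrow> real ^ 'n" where
  "n_op E \<omega> \<rho> a b =
     (laplacian E \<omega> a ** pinv (laplacian E \<omega> \<rho>)) *v b
     - (laplacian E \<omega> b ** pinv (laplacian E \<omega> \<rho>)) *v a"

end

theory Submission
  imports Defs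
begin

text \<open>
  Write \<open>B = L(\<rho>)\<^sup>\<dagger>\<close>, \<open>g(u, v) = u \<bullet> B v\<close> and \<open>K v w = L(v) B w\<close>.  The interior of the simplex is
  an open piece of an affine hyperplane, so every vector field differentiates along straight lines
  and \<open>\<nabla>\<^sub>X Y\<close> is the flat derivative plus a Christoffel term.  The curvature is then the usual
  expression in Christoffel symbols of the first kind,
  \<open>g(R(a, b) c, d) = \<partial>\<^sub>a \<Gamma>(b, c; d) - \<partial>\<^sub>b \<Gamma>(a, c; d) - g(\<Gamma>(a, d), \<Gamma>(b, c)) + g(\<Gamma>(b, d), \<Gamma>(a, c))\<close>,
  and everything in it is explicit for the Wasserstein metric.

  The one analytic input is the derivative of the metric.  On a connected graph with \<open>\<rho> > 0\<close> the
  kernel of \<open>L(\<rho>)\<close> consists of the constants, whatever \<open>\<rho>\<close> is, so \<open>B L(\<rho>) = L(\<rho>) B\<close> is the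
  fixed projection onto mean-zero vectors (\<open>laplacian_pinv\<close>).  Hence a resolvent identity holds
  and gives \<open>\<partial>\<^sub>\<sigma> B = - B L(\<sigma>) B\<close> (\<open>pinv_has_derivative\<close>); since \<open>L\<close> is linear in its weight, the
  metric and \<open>K\<close> are differentiated by the product rule.  Koszul's formula (\<open>koszul\<close>) then gives
  \<open>\<Gamma>(a, b; d) = (g(a, K d b) - g(b, K a d) - g(a, K b d)) / 2\<close>, and the duality
  \<open>u \<bullet> L(a) v = a \<bullet> (\<nabla>u \<circ> \<nabla>v)\<close> (\<open>laplacian_form_edge_prod\<close>) turns the first term into
  the pairing of \<open>d\<close> with \<open>Q a b = L(\<rho>)(\<nabla>B a \<circ> \<nabla>B b)\<close>.

  The flat second derivatives of a field cancel in the curvature because the flat derivatives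
  along \<open>X\<close> and \<open>Y\<close> have commutator the derivative along \<open>[X, Y]\<close> (\<open>dir_deriv_commutator\<close>), which is
  the symmetry of second derivatives on the simplex.  What remains
  (\<open>curvature_christoffel\<close>) is a quadratic expression in the vectors \<open>K x y\<close> and \<open>Q x y\<close>; since
  \<open>m a b = - (K a b + K b a) + Q a b / 2\<close> and \<open>n a b = K a b - K b a\<close>, collecting terms gives the claim
  (\<open>christoffel_curvature_algebra\<close>).
\<close>

section \<open>Directional derivatives on the open simplex\<close>

text \<open>\<open>dir_deriv\<close> has a value even where the derivative does not exist; product and chain rules need
  the relational form.\<close>

definition has_dir_deriv ::
  "(real ^ 'n \<Rightarrow> 'b::real_normed_vector) \<Rightarrow> 'b \<Rightarrow> real ^ 'n \<Rightarrow> real ^ 'n \<Rightarrow> bool" where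
  "has_dir_deriv f f' \<rho> \<sigma> \<longleftrightarrow> ((\<lambda>t. f (\<rho> + t *\<^sub>R \<sigma>)) has_vector_derivative f') (at 0)"

lemma has_dir_deriv_imp_eq: "has_dir_deriv f f' \<rho> \<sigma> \<Longrightarrow> dir_deriv f \<rho> \<sigma> = f'"
  unfolding has_dir_deriv_def dir_deriv_def by (rule vector_derivative_at)

lemma has_dir_deriv_unique:
  "has_dir_deriv f d \<rho> \<sigma> \<Longrightarrow> has_dir_deriv f d' \<rho> \<sigma> \<Longrightarrow> d = d'"
  using has_dir_deriv_imp_eq by blast

lemma tangent_closed:
  fixes \<sigma> \<tau> :: "real ^ 'n"
  shows "0 \<in> (tangent :: (real ^ 'n) set)"
    and "\<sigma> \<in> tangent \<Longrightarrow> \<tau> \<in> tangent \<Longrightarrow> \<sigma> + \<tau> \<in> tangent"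
    and "\<sigma> \<in> tangent \<Longrightarrow> \<tau> \<in> tangent \<Longrightarrow> \<sigma> - \<tau> \<in> tangent"
    and "\<sigma> \<in> tangent \<Longrightarrow> c *\<^sub>R \<sigma> \<in> tangent"
    and "\<sigma> \<in> tangent \<Longrightarrow> - \<sigma> \<in> tangent"
  by (auto simp: tangent_def sum.distrib sum_subtractf sum_negf simp flip: sum_distrib_left)

lemma open_simplex_slice:
  fixes \<rho> \<sigma> :: "real ^ 'n"
  assumes "\<rho> \<in> simplex_int" "\<sigma> \<in> tangent"
  shows "open {t. \<rho> + t *\<^sub>R \<sigma> \<in> simplex_int}"
proof -
  have "(\<Sum>i\<in>UNIV. (\<rho> + t *\<^sub>R \<sigma>) $ i) = 1" for t
    using assms by (simp add: simplex_int_def tangent_def sum.distrib flip: sum_distrib_left)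
  then have eq: "{t. \<rho> + t *\<^sub>R \<sigma> \<in> simplex_int} = (\<Inter>i. {t. 0 < (\<rho> + t *\<^sub>R \<sigma>) $ i})"
    by (auto simp: simplex_int_def)
  show ?thesis
    unfolding eq by (intro open_INT finite ballI open_Collect_less continuous_intros)
qed

lemma eventually_simplex:
  fixes \<rho> \<sigma> :: "real ^ 'n"
  assumes "\<rho> \<in> simplex_int" "\<sigma> \<in> tangent"
  shows "\<forall>\<^sub>F t in nhds 0. \<rho> + t *\<^sub>R \<sigma> \<in> simplex_int"
  using open_simplex_slice[OF assms] assms(1) unfolding eventually_nhds by fastforce

lemma has_dir_deriv_cong:
  assumes "\<rho> \<in> simplex_int" "\<sigma> \<in> tangent" "\<And>x. x \<in> simplex_int \<Longrightarrow> f x = g x"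
    and "has_dir_deriv f d \<rho> \<sigma>"
  shows "has_dir_deriv g d \<rho> \<sigma>"
  using assms(4) unfolding has_dir_deriv_def
  by (rule has_vector_derivative_transform_within_open[OF _ open_simplex_slice[OF assms(1,2)]])
     (use assms in auto)

lemma dir_deriv_cong:
  assumes "\<rho> \<in> simplex_int" "\<sigma> \<in> tangent" "\<And>x. x \<in> simplex_int \<Longrightarrow> f x = g x"
  shows "dir_deriv f \<rho> \<sigma> = dir_deriv g \<rho> \<sigma>"
proof -
  have "has_dir_deriv f d \<rho> \<sigma> \<longleftrightarrow> has_dir_deriv g d \<rho> \<sigma>" for d
    using has_dir_deriv_cong[OF assms(1,2)] assms(3) by metis
  then show ?thesis
    unfolding dir_deriv_def vector_derivative_def has_dir_deriv_def by simp
qed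

text \<open>Differentiability is only assumed within the simplex, which has empty interior in the ambient
  space.  A line through \<open>\<rho>\<close> in a tangent direction stays in the simplex for small times, so
  the derivative along it is still an unrestricted one-variable derivative.\<close>

lemma differentiable_on_simplex_imp_dir_deriv:
  assumes "f differentiable_on simplex_int" and \<rho>: "\<rho> \<in> simplex_int"
  obtains f' where "bounded_linear f'" "\<And>\<sigma>. \<sigma> \<in> tangent \<Longrightarrow> has_dir_deriv f (f' \<sigma>) \<rho> \<sigma>"
proof -
  obtain f' where f': "(f has_derivative f') (at \<rho> within simplex_int)"
    using assms unfolding differentiable_on_def differentiable_def by blast
  show ?thesis
  proof
    show lin: "bounded_linear f'"
      using f' by (rule has_derivative_bounded_linear)
    fix \<sigma> :: "real ^ 'a" assume \<sigma>: "\<sigma> \<in> tangent"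
    define T where "T = {t. \<rho> + t *\<^sub>R \<sigma> \<in> simplex_int}"
    have T: "open T" "0 \<in> T"
      using open_simplex_slice[OF \<rho> \<sigma>] \<rho> by (auto simp: T_def)
    have "((\<lambda>t. \<rho> + t *\<^sub>R \<sigma>) has_derivative (\<lambda>t. t *\<^sub>R \<sigma>)) (at 0 within T)"
      using has_derivative_add[OF has_derivative_const
          bounded_linear_imp_has_derivative[OF bounded_linear_scaleR_left]] by simp
    moreover have "(f has_derivative f') (at (\<rho> + 0 *\<^sub>R \<sigma>) within (\<lambda>t. \<rho> + t *\<^sub>R \<sigma>) ` T)"
    proof -
      have "(\<lambda>t. \<rho> + t *\<^sub>R \<sigma>) ` T \<subseteq> simplex_int"
        by (auto simp: T_def)
      then show ?thesis
        using has_derivative_subset[OF f'] by simp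
    qed
    ultimately have "((\<lambda>t. f (\<rho> + t *\<^sub>R \<sigma>)) has_derivative (\<lambda>t. f' (t *\<^sub>R \<sigma>))) (at 0 within T)"
      by (rule has_derivative_in_compose)
    then show "has_dir_deriv f (f' \<sigma>) \<rho> \<sigma>"
      unfolding has_dir_deriv_def has_vector_derivative_def at_within_open[OF T(2,1)]
        linear_scale[OF bounded_linear.linear[OF lin]] .
  qed
qed

lemma has_dir_deriv_dir_deriv:
  assumes "f differentiable_on simplex_int" "\<rho> \<in> simplex_int" "\<sigma> \<in> tangent"
  shows "has_dir_deriv f (dir_deriv f \<rho> \<sigma>) \<rho> \<sigma>"
proof -
  obtain f' where "\<And>\<sigma>. \<sigma> \<in> tangent \<Longrightarrow> has_dir_deriv f (f' \<sigma>) \<rho> \<sigma>"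
    using differentiable_on_simplex_imp_dir_deriv[OF assms(1,2)] by blast
  then have "has_dir_deriv f (f' \<sigma>) \<rho> \<sigma>"
    using assms(3) by blast
  then show ?thesis
    using has_dir_deriv_imp_eq by fastforce
qed

lemma dir_deriv_linear:
  assumes "f differentiable_on simplex_int" "\<rho> \<in> simplex_int"
  obtains f' where "bounded_linear f'" "\<And>\<sigma>. \<sigma> \<in> tangent \<Longrightarrow> dir_deriv f \<rho> \<sigma> = f' \<sigma>"
proof -
  obtain f' where f': "bounded_linear f'"
    "\<And>\<sigma>. \<sigma> \<in> tangent \<Longrightarrow> has_dir_deriv f (f' \<sigma>) \<rho> \<sigma>"
    using differentiable_on_simplex_imp_dir_deriv[OF assms] by blast
  show ?thesis
    by (rule that[OF f'(1)]) (rule has_dir_deriv_imp_eq[OF f'(2)])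
qed

lemma has_dir_deriv_line:
  assumes "f differentiable_on simplex_int" "\<rho> + s *\<^sub>R \<sigma> \<in> simplex_int" "\<sigma> \<in> tangent"
  shows "((\<lambda>t. f (\<rho> + t *\<^sub>R \<sigma>)) has_vector_derivative dir_deriv f (\<rho> + s *\<^sub>R \<sigma>) \<sigma>) (at s)"
proof -
  have "((\<lambda>t. f (\<rho> + s *\<^sub>R \<sigma> + t *\<^sub>R \<sigma>)) has_vector_derivative dir_deriv f (\<rho> + s *\<^sub>R \<sigma>) \<sigma>)
          (at ((\<lambda>t. t - s) s))"
    using has_dir_deriv_dir_deriv[OF assms] by (simp add: has_dir_deriv_def)
  moreover have "((\<lambda>t. t - s) has_vector_derivative 1) (at s)"
    by (auto intro!: derivative_eq_intros)
  ultimately have "(((\<lambda>t. f (\<rho> + s *\<^sub>R \<sigma> + t *\<^sub>R \<sigma>)) \<circ> (\<lambda>t. t - s)) has_vector_derivative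
      1 *\<^sub>R dir_deriv f (\<rho> + s *\<^sub>R \<sigma>) \<sigma>) (at s)"
    by (intro vector_diff_chain_at)
  then show ?thesis
    by (simp add: o_def algebra_simps)
qed

text \<open>A derivative in a tangent direction at a point of the simplex sees only values on the simplex, so
  this passes through all orders.  It is needed because the Lie bracket agrees with
  \<open>\<nabla>\<^sub>X Y - \<nabla>\<^sub>Y X\<close> only there.\<close>

lemma Ck_cong:
  assumes "\<And>x. x \<in> simplex_int \<Longrightarrow> f x = g x" "Ck k f"
  shows "Ck k g"
  using assms
proof (induction k arbitrary: f g)
  case 0
  then show ?case by (simp cong: continuous_on_cong)
next
  case (Suc k)
  have "f differentiable_on simplex_int"
    using Suc.prems(2) by simp
  then have "g differentiable_on simplex_int"
    using Suc.prems(1) unfolding differentiable_on_def differentiable_def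
    by (metis has_derivative_transform)
  moreover have "Ck k (\<lambda>\<rho>. dir_deriv g \<rho> \<sigma>)" if "\<sigma> \<in> tangent" for \<sigma>
    by (rule Suc.IH[of "\<lambda>\<rho>. dir_deriv f \<rho> \<sigma>"])
       (use Suc.prems that in \<open>auto intro: dir_deriv_cong\<close>)
  ultimately show ?case by simp
qed

lemma dir_deriv_const: "dir_deriv (\<lambda>_. c) \<rho> \<sigma> = 0"
  unfolding dir_deriv_def by simp

lemma Ck_const: "Ck k (\<lambda>_. c)"
  by (induction k arbitrary: c) (auto simp: dir_deriv_const)

lemma has_dir_deriv_diff:
  "has_dir_deriv f d \<rho> \<sigma> \<Longrightarrow> has_dir_deriv g d' \<rho> \<sigma>
    \<Longrightarrow> has_dir_deriv (\<lambda>x. f x - g x) (d - d') \<rho> \<sigma>"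
  unfolding has_dir_deriv_def by (rule has_vector_derivative_diff)

lemma Ck_diff: "Ck k f \<Longrightarrow> Ck k g \<Longrightarrow> Ck k (\<lambda>x. f x - g x)"
proof (induction k arbitrary: f g)
  case 0
  then show ?case by (simp add: continuous_on_diff)
next
  case (Suc k)
  have d: "f differentiable_on simplex_int" "g differentiable_on simplex_int"
    using Suc.prems by auto
  have "Ck k (\<lambda>\<rho>. dir_deriv (\<lambda>x. f x - g x) \<rho> \<sigma>)" if \<sigma>: "\<sigma> \<in> tangent" for \<sigma>
  proof (rule Ck_cong)
    show "Ck k (\<lambda>\<rho>. dir_deriv f \<rho> \<sigma> - dir_deriv g \<rho> \<sigma>)"
      using Suc.IH Suc.prems \<sigma> by simp
    show "dir_deriv f \<rho> \<sigma> - dir_deriv g \<rho> \<sigma> = dir_deriv (\<lambda>x. f x - g x) \<rho> \<sigma>"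
      if "\<rho> \<in> simplex_int" for \<rho>
      using has_dir_deriv_diff[OF has_dir_deriv_dir_deriv[OF d(1) that \<sigma>]
          has_dir_deriv_dir_deriv[OF d(2) that \<sigma>], THEN has_dir_deriv_imp_eq] by simp
  qed
  with d show ?case by (simp add: differentiable_on_diff)
qed

lemma smooth_imp_differentiable: "smooth f \<Longrightarrow> f differentiable_on simplex_int"
  using Ck.simps(2) unfolding smooth_def by blast

lemma smooth_dir_deriv: "smooth f \<Longrightarrow> \<sigma> \<in> tangent \<Longrightarrow> smooth (\<lambda>\<rho>. dir_deriv f \<rho> \<sigma>)"
  using Ck.simps(2) unfolding smooth_def by blast

lemma smooth_imp_continuous: "smooth f \<Longrightarrow> continuous_on simplex_int f"
  using Ck.simps(1) unfolding smooth_def by blast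

lemma const_vector_field: "\<sigma> \<in> tangent \<Longrightarrow> (\<lambda>_. \<sigma>) \<in> vector_fields"
  by (simp add: vector_fields_def smooth_def Ck_const)

lemma dir_deriv_tangent:
  assumes "X \<in> vector_fields" "\<rho> \<in> simplex_int" "\<sigma> \<in> tangent"
  shows "dir_deriv X \<rho> \<sigma> \<in> tangent"
proof -
  let ?s = "\<lambda>v :: real ^ 'a. \<Sum>i\<in>UNIV. v $ i"
  have "bounded_linear ?s"
    by (intro bounded_linear_sum bounded_linear_vec_nth)
  moreover have "has_dir_deriv X (dir_deriv X \<rho> \<sigma>) \<rho> \<sigma>"
    using assms by (auto intro!: has_dir_deriv_dir_deriv smooth_imp_differentiable simp: vector_fields_def)
  ultimately have "has_dir_deriv (\<lambda>x. ?s (X x)) (?s (dir_deriv X \<rho> \<sigma>)) \<rho> \<sigma>"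
    unfolding has_dir_deriv_def by (rule bounded_linear.has_vector_derivative)
  moreover have "has_dir_deriv (\<lambda>x. ?s (X x)) 0 \<rho> \<sigma>"
    by (rule has_dir_deriv_cong[OF assms(2,3), of "\<lambda>_. 0"])
       (use assms in \<open>auto simp: vector_fields_def tangent_def has_dir_deriv_def\<close>)
  ultimately show ?thesis
    using has_dir_deriv_unique unfolding tangent_def by blast
qed

section \<open>Symmetry of second derivatives\<close>

text \<open>Apply the mean value theorem to \<open>s \<mapsto> f(\<rho> + h\<tau> + s\<sigma>) - f(\<rho> + s\<sigma>)\<close>, and then to the difference of
  \<open>\<sigma>\<close>-derivatives that it produces as a function of the \<open>\<tau>\<close>-coordinate.\<close>

lemma mixed_difference_mvt:
  fixes f :: "real ^ 'n \<Rightarrow> real"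
  assumes f: "smooth f" and t: "\<sigma> \<in> tangent" "\<tau> \<in> tangent" and h: "h > 0"
    and box: "\<And>s t. 0 \<le> s \<Longrightarrow> s \<le> h \<Longrightarrow> 0 \<le> t \<Longrightarrow> t \<le> h \<Longrightarrow> \<rho> + s *\<^sub>R \<sigma> + t *\<^sub>R \<tau> \<in> simplex_int"
  obtains s t where "0 < s" "s < h" "0 < t" "t < h"
    "f (\<rho> + h *\<^sub>R \<sigma> + h *\<^sub>R \<tau>) - f (\<rho> + h *\<^sub>R \<sigma>) - f (\<rho> + h *\<^sub>R \<tau>) + f \<rho>
      = h\<^sup>2 * dir_deriv (\<lambda>x. dir_deriv f x \<sigma>) (\<rho> + s *\<^sub>R \<sigma> + t *\<^sub>R \<tau>) \<tau>"
proof -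
  define u where "u s = f (\<rho> + h *\<^sub>R \<tau> + s *\<^sub>R \<sigma>) - f (\<rho> + s *\<^sub>R \<sigma>)" for s
  have u': "(u has_real_derivative
      dir_deriv f (\<rho> + h *\<^sub>R \<tau> + s *\<^sub>R \<sigma>) \<sigma> - dir_deriv f (\<rho> + s *\<^sub>R \<sigma>) \<sigma>) (at s)"
    if "0 \<le> s" "s \<le> h" for s
    unfolding u_def has_real_derivative_iff_has_vector_derivative
    using box[OF that, of h] box[OF that, of 0] h
    by (intro has_vector_derivative_diff has_dir_deriv_line smooth_imp_differentiable f t)
       (auto simp: algebra_simps)
  obtain s where s: "0 < s" "s < h" and us: "u h - u 0 =
      h * (dir_deriv f (\<rho> + h *\<^sub>R \<tau> + s *\<^sub>R \<sigma>) \<sigma> - dir_deriv f (\<rho> + s *\<^sub>R \<sigma>) \<sigma>)"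
    using MVT2[OF h u'] by auto
  define w where "w t = dir_deriv f (\<rho> + s *\<^sub>R \<sigma> + t *\<^sub>R \<tau>) \<sigma>" for t
  have w': "(w has_real_derivative
      dir_deriv (\<lambda>x. dir_deriv f x \<sigma>) (\<rho> + s *\<^sub>R \<sigma> + t *\<^sub>R \<tau>) \<tau>) (at t)"
    if "0 \<le> t" "t \<le> h" for t
    unfolding w_def has_real_derivative_iff_has_vector_derivative
    using box[of s t] that s
    by (intro has_dir_deriv_line smooth_imp_differentiable smooth_dir_deriv f t) auto
  obtain t where t: "0 < t" "t < h" and wt: "w h - w 0 =
      h * dir_deriv (\<lambda>x. dir_deriv f x \<sigma>) (\<rho> + s *\<^sub>R \<sigma> + t *\<^sub>R \<tau>) \<tau>"
    using MVT2[OF h w'] by auto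
  show ?thesis
  proof (rule that[OF s t])
    have "dir_deriv f (\<rho> + h *\<^sub>R \<tau> + s *\<^sub>R \<sigma>) \<sigma> - dir_deriv f (\<rho> + s *\<^sub>R \<sigma>) \<sigma> = w h - w 0"
      by (simp add: w_def algebra_simps)
    with us wt show "f (\<rho> + h *\<^sub>R \<sigma> + h *\<^sub>R \<tau>) - f (\<rho> + h *\<^sub>R \<sigma>) - f (\<rho> + h *\<^sub>R \<tau>) + f \<rho>
      = h\<^sup>2 * dir_deriv (\<lambda>x. dir_deriv f x \<sigma>) (\<rho> + s *\<^sub>R \<sigma> + t *\<^sub>R \<tau>) \<tau>"
      by (simp add: u_def power2_eq_square algebra_simps)
  qed
qed

lemma small_box_in_simplex_ball:
  fixes \<rho> :: "real ^ 'n"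
  assumes \<rho>: "\<rho> \<in> simplex_int" and t: "\<sigma> \<in> tangent" "\<tau> \<in> tangent" and "\<delta> > 0"
  obtains h where "h > 0" "\<And>s t. 0 \<le> s \<Longrightarrow> s \<le> h \<Longrightarrow> 0 \<le> t \<Longrightarrow> t \<le> h \<Longrightarrow>
    \<rho> + s *\<^sub>R \<sigma> + t *\<^sub>R \<tau> \<in> simplex_int \<and> dist (\<rho> + s *\<^sub>R \<sigma> + t *\<^sub>R \<tau>) \<rho> < \<delta>"
proof -
  let ?P = "{x :: real ^ 'n. \<forall>i. x $ i > 0}"
  have "?P = (\<Inter>i. {x. 0 < x $ i})" by auto
  then have "open ?P"
    by (auto intro!: open_INT open_Collect_less continuous_intros)
  moreover have "\<rho> \<in> ?P" using \<rho> by (simp add: simplex_int_def)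
  ultimately obtain e where e: "e > 0" "ball \<rho> e \<subseteq> ?P"
    using openE by blast
  define r where "r = min e \<delta>"
  \<comment> \<open>The summand 1 keeps the denominator positive when both directions vanish.\<close>
  define h where "h = r / (2 * (norm \<sigma> + norm \<tau> + 1))"
  have r: "r > 0" using e assms by (simp add: r_def)
  have pos: "norm \<sigma> + norm \<tau> + 1 > 0"
    by (simp add: add_nonneg_pos)
  show ?thesis
  proof
    show h: "h > 0" using r pos by (simp add: h_def)
    fix s t assume st: "0 \<le> s" "s \<le> h" "0 \<le> t" "t \<le> h"
    have "norm (s *\<^sub>R \<sigma> + t *\<^sub>R \<tau>) \<le> s * norm \<sigma> + t * norm \<tau>"
      using st norm_triangle_ineq[of "s *\<^sub>R \<sigma>" "t *\<^sub>R \<tau>"] by simp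
    also have "\<dots> \<le> h * norm \<sigma> + h * norm \<tau>"
      using st by (intro add_mono mult_right_mono) auto
    also have "\<dots> < h * (2 * (norm \<sigma> + norm \<tau> + 1))"
      using h by (simp add: algebra_simps add_strict_increasing2)
    also have "\<dots> = r" using pos by (simp add: h_def)
    finally have d: "dist (\<rho> + s *\<^sub>R \<sigma> + t *\<^sub>R \<tau>) \<rho> < r"
      by (simp add: dist_norm add.assoc)
    then have "\<rho> + s *\<^sub>R \<sigma> + t *\<^sub>R \<tau> \<in> ?P"
      using e by (auto simp: r_def dist_commute)
    moreover have "(\<Sum>i\<in>UNIV. (\<rho> + s *\<^sub>R \<sigma> + t *\<^sub>R \<tau>) $ i) = 1"
      using \<rho> t by (simp add: simplex_int_def tangent_def sum.distrib flip: sum_distrib_left)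
    ultimately show "\<rho> + s *\<^sub>R \<sigma> + t *\<^sub>R \<tau> \<in> simplex_int \<and> dist (\<rho> + s *\<^sub>R \<sigma> + t *\<^sub>R \<tau>) \<rho> < \<delta>"
      using d by (simp add: simplex_int_def r_def)
  qed
qed

text \<open>The mixed difference is symmetric in \<open>\<sigma>\<close> and \<open>\<tau>\<close>, so it equals \<open>h\<^sup>2\<close> times either mixed
  derivative at suitable points close to \<open>\<rho>\<close>; continuity brings both points to \<open>\<rho>\<close>.\<close>

lemma dir_deriv_commute_real:
  fixes f :: "real ^ 'n \<Rightarrow> real"
  assumes f: "smooth f" and \<rho>: "\<rho> \<in> simplex_int" and t: "\<sigma> \<in> tangent" "\<tau> \<in> tangent"
  shows "dir_deriv (\<lambda>x. dir_deriv f x \<sigma>) \<rho> \<tau> = dir_deriv (\<lambda>x. dir_deriv f x \<tau>) \<rho> \<sigma>"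
    (is "?H \<rho> = ?H' \<rho>")
proof (rule ccontr)
  assume neq: "?H \<rho> \<noteq> ?H' \<rho>"
  define e where "e = \<bar>?H \<rho> - ?H' \<rho>\<bar> / 2"
  have e: "e > 0" using neq by (simp add: e_def)
  have "continuous_on simplex_int ?H" "continuous_on simplex_int ?H'"
    by (intro smooth_imp_continuous smooth_dir_deriv f t)+
  \<comment> \<open>\<open>e\<close> is half the supposed gap, so two approximations with errors below \<open>e\<close> cannot bridge it.\<close>
  note cont = this[unfolded continuous_on_iff, rule_format, OF \<rho> e]
  obtain d where d: "d > 0"
    and H: "\<And>x. x \<in> simplex_int \<Longrightarrow> dist x \<rho> < d \<Longrightarrow> dist (?H x) (?H \<rho>) < e"
    using cont(1) by blast
  obtain d' where d': "d' > 0"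
    and H': "\<And>x. x \<in> simplex_int \<Longrightarrow> dist x \<rho> < d' \<Longrightarrow> dist (?H' x) (?H' \<rho>) < e"
    using cont(2) by blast
  obtain h where h: "h > 0" and box: "\<And>s t. 0 \<le> s \<Longrightarrow> s \<le> h \<Longrightarrow> 0 \<le> t \<Longrightarrow> t \<le> h \<Longrightarrow>
      \<rho> + s *\<^sub>R \<sigma> + t *\<^sub>R \<tau> \<in> simplex_int \<and> dist (\<rho> + s *\<^sub>R \<sigma> + t *\<^sub>R \<tau>) \<rho> < min d d'"
    using small_box_in_simplex_ball[OF \<rho> t, of "min d d'"] d d' by auto
  obtain s t where st: "0 < s" "s < h" "0 < t" "t < h" and
    1: "f (\<rho> + h *\<^sub>R \<sigma> + h *\<^sub>R \<tau>) - f (\<rho> + h *\<^sub>R \<sigma>) - f (\<rho> + h *\<^sub>R \<tau>) + f \<rho>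
      = h\<^sup>2 * ?H (\<rho> + s *\<^sub>R \<sigma> + t *\<^sub>R \<tau>)"
    using mixed_difference_mvt[OF f t h, of \<rho>] box by blast
  have box': "\<rho> + s *\<^sub>R \<tau> + t *\<^sub>R \<sigma> \<in> simplex_int"
    if "0 \<le> s" "s \<le> h" "0 \<le> t" "t \<le> h" for s t
    using box[of t s] that by (simp add: algebra_simps)
  obtain s' t' where st': "0 < s'" "s' < h" "0 < t'" "t' < h" and
    2: "f (\<rho> + h *\<^sub>R \<tau> + h *\<^sub>R \<sigma>) - f (\<rho> + h *\<^sub>R \<tau>) - f (\<rho> + h *\<^sub>R \<sigma>) + f \<rho>
      = h\<^sup>2 * ?H' (\<rho> + s' *\<^sub>R \<tau> + t' *\<^sub>R \<sigma>)"
    using mixed_difference_mvt[OF f t(2,1) h, of \<rho>] box' by blast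
  have swap: "\<rho> + s' *\<^sub>R \<tau> + t' *\<^sub>R \<sigma> = \<rho> + t' *\<^sub>R \<sigma> + s' *\<^sub>R \<tau>"
    "\<rho> + h *\<^sub>R \<tau> + h *\<^sub>R \<sigma> = \<rho> + h *\<^sub>R \<sigma> + h *\<^sub>R \<tau>"
    by simp_all
  have "h\<^sup>2 * ?H (\<rho> + s *\<^sub>R \<sigma> + t *\<^sub>R \<tau>) = h\<^sup>2 * ?H' (\<rho> + t' *\<^sub>R \<sigma> + s' *\<^sub>R \<tau>)"
    using 1 2 unfolding swap by linarith
  then have "?H (\<rho> + s *\<^sub>R \<sigma> + t *\<^sub>R \<tau>) = ?H' (\<rho> + t' *\<^sub>R \<sigma> + s' *\<^sub>R \<tau>)"
    using h by simp
  moreover have "dist (?H (\<rho> + s *\<^sub>R \<sigma> + t *\<^sub>R \<tau>)) (?H \<rho>) < e"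
    using box[of s t] st by (intro H) auto
  moreover have "dist (?H' (\<rho> + t' *\<^sub>R \<sigma> + s' *\<^sub>R \<tau>)) (?H' \<rho>) < e"
    using box[of t' s'] st' by (intro H') auto
  ultimately have "\<bar>?H \<rho> - ?H' \<rho>\<bar> < e + e"
    unfolding dist_real_def by linarith
  then show False
    by (simp add: e_def)
qed

lemma has_dir_deriv_inner:
  "has_dir_deriv f d \<rho> \<sigma> \<Longrightarrow> has_dir_deriv (\<lambda>x. f x \<bullet> v) (d \<bullet> v) \<rho> \<sigma>"
  unfolding has_dir_deriv_def
  by (rule bounded_linear.has_vector_derivative[OF bounded_linear_inner_left])

lemma dir_deriv_inner:
  assumes "f differentiable_on simplex_int" "\<rho> \<in> simplex_int" "\<sigma> \<in> tangent"
  shows "dir_deriv (\<lambda>x. f x \<bullet> v) \<rho> \<sigma> = dir_deriv f \<rho> \<sigma> \<bullet> v"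
  by (rule has_dir_deriv_imp_eq[OF has_dir_deriv_inner[OF has_dir_deriv_dir_deriv[OF assms]]])

lemma Ck_inner: "Ck k f \<Longrightarrow> Ck k (\<lambda>x. f x \<bullet> v)"
proof (induction k arbitrary: f)
  case 0
  then show ?case by (simp add: continuous_on_inner)
next
  case (Suc k)
  have d: "f differentiable_on simplex_int" using Suc.prems by simp
  have "Ck k (\<lambda>\<rho>. dir_deriv (\<lambda>x. f x \<bullet> v) \<rho> \<sigma>)" if \<sigma>: "\<sigma> \<in> tangent" for \<sigma>
    by (rule Ck_cong[of "\<lambda>\<rho>. dir_deriv f \<rho> \<sigma> \<bullet> v"])
       (use Suc \<sigma> dir_deriv_inner[OF d] in auto)
  moreover have "(\<lambda>x. f x \<bullet> v) differentiable_on simplex_int"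
    using d unfolding differentiable_on_def by (auto intro!: differentiable_inner)
  ultimately show ?case by simp
qed

lemma dir_deriv_commute:
  fixes f :: "real ^ 'n \<Rightarrow> 'b::real_inner"
  assumes f: "smooth f" and \<rho>: "\<rho> \<in> simplex_int" and t: "\<sigma> \<in> tangent" "\<tau> \<in> tangent"
  shows "dir_deriv (\<lambda>x. dir_deriv f x \<sigma>) \<rho> \<tau> = dir_deriv (\<lambda>x. dir_deriv f x \<tau>) \<rho> \<sigma>"
proof (rule vector_eq_rdot[THEN iffD1], rule allI)
  fix v
  have g: "smooth (\<lambda>x. f x \<bullet> v)"
    using f by (simp add: smooth_def Ck_inner)
  have *: "dir_deriv (\<lambda>x. dir_deriv f x \<sigma>) \<rho> \<tau> \<bullet> v
      = dir_deriv (\<lambda>x. dir_deriv (\<lambda>x. f x \<bullet> v) x \<sigma>) \<rho> \<tau>"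
    if "\<sigma> \<in> tangent" "\<tau> \<in> tangent" for \<sigma> \<tau>
  proof -
    have "dir_deriv (\<lambda>x. dir_deriv f x \<sigma>) \<rho> \<tau> \<bullet> v = dir_deriv (\<lambda>x. dir_deriv f x \<sigma> \<bullet> v) \<rho> \<tau>"
      by (rule dir_deriv_inner[symmetric])
         (intro smooth_imp_differentiable smooth_dir_deriv f that \<rho>)+
    also have "\<dots> = dir_deriv (\<lambda>x. dir_deriv (\<lambda>x. f x \<bullet> v) x \<sigma>) \<rho> \<tau>"
      by (rule dir_deriv_cong[OF \<rho> that(2)])
         (use dir_deriv_inner[OF smooth_imp_differentiable[OF f]] that in auto)
    finally show ?thesis .
  qed
  show "dir_deriv (\<lambda>x. dir_deriv f x \<sigma>) \<rho> \<tau> \<bullet> v = dir_deriv (\<lambda>x. dir_deriv f x \<tau>) \<rho> \<sigma> \<bullet> v"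
    using dir_deriv_commute_real[OF g \<rho> t] * t by simp
qed

section \<open>Flat derivatives along vector fields\<close>

text \<open>The orthogonal projections of the standard basis onto the tangent space.  They are linearly
  dependent, but a tangent vector expands in them with its own coordinates as coefficients, so no
  vertex has to be singled out.\<close>

definition centred_axis :: "'n::finite \<Rightarrow> real ^ 'n" where
  "centred_axis i = axis i 1 - (\<chi> j. 1 / real CARD('n))"

lemma centred_axis_tangent: "centred_axis i \<in> tangent"
  by (simp add: centred_axis_def tangent_def sum_subtractf axis_def)

lemma tangent_expand:
  fixes \<sigma> :: "real ^ 'n"
  assumes "\<sigma> \<in> tangent"
  shows "\<sigma> = (\<Sum>i\<in>UNIV. \<sigma> $ i *\<^sub>R centred_axis i)"
proof -
  have "(\<Sum>i\<in>UNIV. \<sigma> $ i *\<^sub>R centred_axis i)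
      = (\<Sum>i\<in>UNIV. \<sigma> $ i *\<^sub>R axis i 1) - (\<Sum>i\<in>UNIV. \<sigma> $ i) *\<^sub>R (\<chi> j. 1 / real CARD('n))"
    by (simp add: centred_axis_def scaleR_diff_right sum_subtractf scaleR_left.sum)
  also have "(\<Sum>i\<in>UNIV. \<sigma> $ i *\<^sub>R axis i 1) = \<sigma>"
    using basis_expansion[of \<sigma>] by (simp add: scalar_mult_eq_scaleR)
  finally show ?thesis
    using assms by (simp add: tangent_def)
qed

lemma dir_deriv_expand:
  assumes "f differentiable_on simplex_int" "\<rho> \<in> simplex_int" "\<sigma> \<in> tangent"
  shows "dir_deriv f \<rho> \<sigma> = (\<Sum>i\<in>UNIV. \<sigma> $ i *\<^sub>R dir_deriv f \<rho> (centred_axis i))"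
proof -
  obtain f' where f': "bounded_linear f'" "\<And>\<sigma>. \<sigma> \<in> tangent \<Longrightarrow> dir_deriv f \<rho> \<sigma> = f' \<sigma>"
    using dir_deriv_linear[OF assms(1,2)] by blast
  have "f' \<sigma> = f' (\<Sum>i\<in>UNIV. \<sigma> $ i *\<^sub>R centred_axis i)"
    using tangent_expand[OF assms(3)] by simp
  also have "\<dots> = (\<Sum>i\<in>UNIV. \<sigma> $ i *\<^sub>R f' (centred_axis i))"
    using f'(1) by (simp add: linear_sum linear_scale bounded_linear.linear)
  finally show ?thesis
    using assms(3) by (simp add: f'(2) centred_axis_tangent)
qed

text \<open>In the coordinates of \<open>Y\<close> this is the product rule.  Reassembling the second-order part
  into the derivative along the frozen vector \<open>Y \<rho>\<close> uses the symmetry of second derivatives twice: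
  linearity is available only in the outer direction.\<close>

lemma has_dir_deriv_along_field:
  fixes f :: "real ^ 'n \<Rightarrow> 'b::real_inner"
  assumes f: "smooth f" and Y: "Y \<in> vector_fields" and \<rho>: "\<rho> \<in> simplex_int" and \<sigma>: "\<sigma> \<in> tangent"
  shows "has_dir_deriv (\<lambda>x. dir_deriv f x (Y x))
      (dir_deriv f \<rho> (dir_deriv Y \<rho> \<sigma>) + dir_deriv (\<lambda>x. dir_deriv f x (Y \<rho>)) \<rho> \<sigma>) \<rho> \<sigma>"
proof -
  let ?b = "centred_axis :: 'n \<Rightarrow> _"
  have df: "f differentiable_on simplex_int" and dY: "Y differentiable_on simplex_int"
    and Yt: "\<And>x. x \<in> simplex_int \<Longrightarrow> Y x \<in> tangent"
    using f Y smooth_imp_differentiable by (auto simp: vector_fields_def)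
  have 1: "has_dir_deriv (\<lambda>x. \<Sum>i\<in>UNIV. Y x $ i *\<^sub>R dir_deriv f x (?b i))
      (\<Sum>i\<in>UNIV. Y \<rho> $ i *\<^sub>R dir_deriv (\<lambda>x. dir_deriv f x (?b i)) \<rho> \<sigma>
             + dir_deriv Y \<rho> \<sigma> $ i *\<^sub>R dir_deriv f \<rho> (?b i)) \<rho> \<sigma>"
    unfolding has_dir_deriv_def
  proof (rule has_vector_derivative_sum)
    fix i
    have "has_dir_deriv Y (dir_deriv Y \<rho> \<sigma>) \<rho> \<sigma>"
      by (rule has_dir_deriv_dir_deriv[OF dY \<rho> \<sigma>])
    then have a: "((\<lambda>t. Y (\<rho> + t *\<^sub>R \<sigma>) $ i) has_real_derivative dir_deriv Y \<rho> \<sigma> $ i) (at 0)"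
      unfolding has_dir_deriv_def has_real_derivative_iff_has_vector_derivative
      by (rule bounded_linear.has_vector_derivative[OF bounded_linear_vec_nth])
    have b: "((\<lambda>t. dir_deriv f (\<rho> + t *\<^sub>R \<sigma>) (?b i)) has_vector_derivative
        dir_deriv (\<lambda>x. dir_deriv f x (?b i)) \<rho> \<sigma>) (at 0)"
      using has_dir_deriv_dir_deriv[OF smooth_imp_differentiable[OF
            smooth_dir_deriv[OF f centred_axis_tangent]] \<rho> \<sigma>]
      unfolding has_dir_deriv_def .
    show "((\<lambda>t. Y (\<rho> + t *\<^sub>R \<sigma>) $ i *\<^sub>R dir_deriv f (\<rho> + t *\<^sub>R \<sigma>) (?b i)) has_vector_derivative
        Y \<rho> $ i *\<^sub>R dir_deriv (\<lambda>x. dir_deriv f x (?b i)) \<rho> \<sigma>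
             + dir_deriv Y \<rho> \<sigma> $ i *\<^sub>R dir_deriv f \<rho> (?b i)) (at 0)"
      using has_vector_derivative_scaleR[OF a b] by simp
  qed
  have "(\<Sum>i\<in>UNIV. Y \<rho> $ i *\<^sub>R dir_deriv (\<lambda>x. dir_deriv f x (?b i)) \<rho> \<sigma>)
      = (\<Sum>i\<in>UNIV. Y \<rho> $ i *\<^sub>R dir_deriv (\<lambda>x. dir_deriv f x \<sigma>) \<rho> (?b i))"
    using dir_deriv_commute[OF f \<rho> _ \<sigma>] centred_axis_tangent by metis
  also have "\<dots> = dir_deriv (\<lambda>x. dir_deriv f x \<sigma>) \<rho> (Y \<rho>)"
    using dir_deriv_expand[OF smooth_imp_differentiable[OF smooth_dir_deriv[OF f \<sigma>]] \<rho> Yt[OF \<rho>]]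
    by simp
  also have "\<dots> = dir_deriv (\<lambda>x. dir_deriv f x (Y \<rho>)) \<rho> \<sigma>"
    by (rule dir_deriv_commute[OF f \<rho> \<sigma> Yt[OF \<rho>]])
  finally have 2: "(\<Sum>i\<in>UNIV. Y \<rho> $ i *\<^sub>R dir_deriv (\<lambda>x. dir_deriv f x (?b i)) \<rho> \<sigma>)
      = dir_deriv (\<lambda>x. dir_deriv f x (Y \<rho>)) \<rho> \<sigma>" .
  have 3: "(\<Sum>i\<in>UNIV. dir_deriv Y \<rho> \<sigma> $ i *\<^sub>R dir_deriv f \<rho> (?b i))
      = dir_deriv f \<rho> (dir_deriv Y \<rho> \<sigma>)"
    using dir_deriv_expand[OF df \<rho> dir_deriv_tangent[OF Y \<rho> \<sigma>]] by simp
  show ?thesis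
    by (rule has_dir_deriv_cong[OF \<rho> \<sigma> _ 1[unfolded sum.distrib 2 3, simplified add.commute]])
       (use dir_deriv_expand[OF df] Yt in auto)
qed

text \<open>The two second-order parts are equal by the symmetry of second derivatives, and the first-order
  parts are exactly the derivative along \<open>[X, Y]\<close>.\<close>

lemma dir_deriv_commutator:
  fixes f :: "real ^ 'n \<Rightarrow> 'b::real_inner"
  assumes f: "smooth f" and X: "X \<in> vector_fields" and Y: "Y \<in> vector_fields"
    and \<rho>: "\<rho> \<in> simplex_int"
  shows "dir_deriv (\<lambda>x. dir_deriv f x (Y x)) \<rho> (X \<rho>) - dir_deriv (\<lambda>x. dir_deriv f x (X x)) \<rho> (Y \<rho>)
    = dir_deriv f \<rho> (lie_bracket X Y \<rho>)"
proof -
  have t: "X \<rho> \<in> tangent" "Y \<rho> \<in> tangent"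
    using X Y \<rho> by (auto simp: vector_fields_def)
  obtain f' where f': "bounded_linear f'" "\<And>\<sigma>. \<sigma> \<in> tangent \<Longrightarrow> dir_deriv f \<rho> \<sigma> = f' \<sigma>"
    using dir_deriv_linear[OF smooth_imp_differentiable[OF f] \<rho>] by blast
  show ?thesis
    unfolding has_dir_deriv_along_field[OF f Y \<rho> t(1), THEN has_dir_deriv_imp_eq]
      has_dir_deriv_along_field[OF f X \<rho> t(2), THEN has_dir_deriv_imp_eq] lie_bracket_def
    using f' X Y t \<rho>
    by (simp add: dir_deriv_commute[OF f \<rho> t] dir_deriv_tangent tangent_closed
        bounded_linear.linear linear_diff)
qed

section \<open>Weighted Laplacians of a connected graph and their pseudo-inverse\<close>

text \<open>The orthogonal projection onto the constant vectors.\<close>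

definition mean_matrix :: "real ^ 'n ^ 'n" where
  "mean_matrix = (\<chi> i j. 1 / real CARD('n))"

lemma mean_matrix_mult_vec: "(mean_matrix *v v) $ i = (\<Sum>j\<in>UNIV. v $ j) / real CARD('n)"
  for v :: "real ^ 'n::finite"
  by (simp add: mean_matrix_def matrix_vector_mult_def sum_divide_distrib)

lemma mean_matrix_tangent: "v \<in> tangent \<Longrightarrow> mean_matrix *v v = 0"
  by (simp add: vec_eq_iff mean_matrix_mult_vec tangent_def)

lemma matrix_sub_mult_distrib:
  fixes A B :: "real ^ 'n ^ 'm" and C :: "real ^ 'k ^ 'n"
  shows "(A - B) ** C = A ** C - B ** C"
  by (simp add: matrix_matrix_mult_def vec_eq_iff sum_subtractf left_diff_distrib)

lemma matrix_mult_sub_distrib: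
  fixes A :: "real ^ 'n ^ 'm" and B C :: "real ^ 'k ^ 'n"
  shows "A ** (B - C) = A ** B - A ** C"
  by (simp add: matrix_matrix_mult_def vec_eq_iff sum_subtractf right_diff_distrib)

lemma matrix_add_mult_distrib:
  fixes A B :: "real ^ 'n ^ 'm" and C :: "real ^ 'k ^ 'n"
  shows "(A + B) ** C = A ** C + B ** C"
  by (simp add: matrix_matrix_mult_def vec_eq_iff sum.distrib distrib_right)

lemma transpose_add: "transpose (A + B) = transpose A + transpose B"
  and transpose_diff: "transpose (C - D) = transpose C - transpose D"
  by (simp_all add: transpose_def vec_eq_iff)

lemma symmetric_matrix_iff:
  fixes A :: "real ^ 'n ^ 'n"
  shows "transpose A = A \<longleftrightarrow> (\<forall>u v. u \<bullet> (A *v v) = v \<bullet> (A *v u))"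
proof -
  have "(\<forall>u v. u \<bullet> (A *v v) = v \<bullet> (A *v u)) \<longleftrightarrow> (\<forall>u v. u \<bullet> (A *v v) = u \<bullet> (transpose A *v v))"
    by (metis dot_lmul_matrix inner_commute transpose_matrix_vector)
  also have "\<dots> \<longleftrightarrow> transpose A = A"
    by (metis matrix_eq vector_eq_ldot)
  finally show ?thesis ..
qed

locale weighted_graph =
  fixes E :: "('n::finite \<times> 'n) set" and \<omega> :: "'n \<Rightarrow> 'n \<Rightarrow> real"
  assumes graph: "connected_weighted_graph E \<omega>"
begin

abbreviation L :: "real ^ 'n \<Rightarrow> real ^ 'n ^ 'n" where "L \<equiv> laplacian E \<omega>"

abbreviation Ld :: "real ^ 'n \<Rightarrow> real ^ 'n ^ 'n" where "Ld \<rho> \<equiv> pinv (L \<rho>)"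

lemma weight_sym: "\<omega> i j = \<omega> j i"
  and weight_pos: "(i, j) \<in> E \<Longrightarrow> \<omega> i j > 0"
  and weight_zero: "(i, j) \<notin> E \<Longrightarrow> \<omega> i j = 0"
  and connected: "(i, j) \<in> E\<^sup>*"
  using graph by (simp_all add: connected_weighted_graph_def)

lemma weight_nonneg: "\<omega> i j \<ge> 0"
  using weight_pos weight_zero by (cases "(i, j) \<in> E") (auto simp: less_imp_le)

lemma laplacian_nth:
  "(L a *v \<Phi>) $ i = (\<Sum>j\<in>UNIV. \<omega> i j * theta a i j * (\<Phi> $ i - \<Phi> $ j))"
  unfolding laplacian_mult_vec
  by (rule sum.mono_neutral_left) (auto simp: nbrs_def weight_zero)

lemma edge_prod_grad_nth:
  "edge_prod E (grad \<omega> u) (grad \<omega> v) $ i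
    = 1 / 2 * (\<Sum>j\<in>UNIV. \<omega> i j * (u $ i - u $ j) * (v $ i - v $ j))"
proof -
  have "sqrt (\<omega> i j) * x * (sqrt (\<omega> i j) * y) = \<omega> i j * x * y" for j x y
    using weight_nonneg[of i j] by (simp add: algebra_simps flip: mult.assoc[of "sqrt _" "sqrt _"])
  note weight = this
  have "edge_prod E (grad \<omega> u) (grad \<omega> v) $ i
      = 1 / 2 * (\<Sum>j\<in>nbrs E i. \<omega> i j * (u $ i - u $ j) * (v $ i - v $ j))"
    unfolding edge_prod_def grad_def vec_lambda_beta by (simp only: weight)
  also have "(\<Sum>j\<in>nbrs E i. \<omega> i j * (u $ i - u $ j) * (v $ i - v $ j))
      = (\<Sum>j\<in>UNIV. \<omega> i j * (u $ i - u $ j) * (v $ i - v $ j))"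
    by (rule sum.mono_neutral_left) (auto simp: nbrs_def weight_zero)
  finally show ?thesis .
qed

lemma theta_sym: "theta a i j = theta a j i"
  by (simp add: theta_def add.commute)

text \<open>Summation by parts: exchanging \<open>i\<close> and \<open>j\<close> changes the sign of \<open>v\<^sub>i - v\<^sub>j\<close> and fixes
  the weights, so the sum may be antisymmetrised in \<open>u\<close>.\<close>

lemma laplacian_form:
  "u \<bullet> (L a *v v)
    = 1 / 2 * (\<Sum>i\<in>UNIV. \<Sum>j\<in>UNIV. \<omega> i j * theta a i j * (u $ i - u $ j) * (v $ i - v $ j))"
proof -
  let ?c = "\<lambda>i j. \<omega> i j * theta a i j * (v $ i - v $ j)"
  have 1: "u \<bullet> (L a *v v) = (\<Sum>i\<in>UNIV. \<Sum>j\<in>UNIV. u $ i * ?c i j)"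
    by (simp add: inner_vec_def laplacian_nth sum_distrib_left)
  also have "\<dots> = (\<Sum>j\<in>UNIV. \<Sum>i\<in>UNIV. u $ i * ?c i j)"
    by (rule sum.swap)
  also have "\<dots> = (\<Sum>i\<in>UNIV. \<Sum>j\<in>UNIV. - (u $ j * ?c i j))"
    by (intro sum.cong refl) (simp add: weight_sym[of i for i] theta_sym[of a i for i] algebra_simps)
  finally have 2: "u \<bullet> (L a *v v) = (\<Sum>i\<in>UNIV. \<Sum>j\<in>UNIV. - (u $ j * ?c i j))" .
  have "2 * (u \<bullet> (L a *v v)) = (\<Sum>i\<in>UNIV. \<Sum>j\<in>UNIV. u $ i * ?c i j - u $ j * ?c i j)"
    using 1 2 by (simp add: sum_subtractf sum_negf)
  also have "\<dots> = (\<Sum>i\<in>UNIV. \<Sum>j\<in>UNIV. \<omega> i j * theta a i j * (u $ i - u $ j) * (v $ i - v $ j))"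
    by (intro sum.cong refl) (simp add: algebra_simps)
  finally show ?thesis by simp
qed

text \<open>The form is linear in the weight \<open>a\<close>, and \<open>a\<^sub>i\<close>, \<open>a\<^sub>j\<close> contribute equally to the average
  \<open>theta a i j\<close> by symmetry.  This moves the derivative of the metric in the direction \<open>d\<close> into a
  pairing with \<open>d\<close>.\<close>

lemma laplacian_form_edge_prod:
  "u \<bullet> (L a *v v) = a \<bullet> edge_prod E (grad \<omega> u) (grad \<omega> v)"
proof -
  let ?c = "\<lambda>i j. \<omega> i j * (u $ i - u $ j) * (v $ i - v $ j)"
  have "(\<Sum>i\<in>UNIV. \<Sum>j\<in>UNIV. a $ j * ?c i j) = (\<Sum>j\<in>UNIV. \<Sum>i\<in>UNIV. a $ j * ?c i j)"
    by (rule sum.swap)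
  also have "\<dots> = (\<Sum>i\<in>UNIV. \<Sum>j\<in>UNIV. a $ i * ?c i j)"
    by (intro sum.cong refl) (simp add: weight_sym[of i for i] algebra_simps)
  finally have swap: "(\<Sum>i\<in>UNIV. \<Sum>j\<in>UNIV. a $ j * ?c i j) = (\<Sum>i\<in>UNIV. \<Sum>j\<in>UNIV. a $ i * ?c i j)" .
  have "(\<Sum>i\<in>UNIV. \<Sum>j\<in>UNIV. \<omega> i j * theta a i j * (u $ i - u $ j) * (v $ i - v $ j))
      = (\<Sum>i\<in>UNIV. \<Sum>j\<in>UNIV. a $ i * ?c i j / 2 + a $ j * ?c i j / 2)"
    by (intro sum.cong refl) (simp add: theta_def field_simps)
  also have "\<dots> = (\<Sum>i\<in>UNIV. \<Sum>j\<in>UNIV. a $ i * ?c i j)"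
    using swap by (simp add: sum.distrib flip: sum_divide_distrib)
  finally show ?thesis
    unfolding laplacian_form by (simp add: inner_vec_def edge_prod_grad_nth sum_distrib_left)
qed

lemma laplacian_symmetric: "u \<bullet> (L a *v v) = v \<bullet> (L a *v u)"
  unfolding laplacian_form by (simp add: algebra_simps)

lemma edge_prod_commute: "edge_prod E v w = edge_prod E w v"
  by (simp add: edge_prod_def mult.commute)

lemma laplacian_tangent: "L a *v \<Phi> \<in> tangent"
proof -
  have "(\<chi> i. 1) \<bullet> (L a *v \<Phi>) = 0"
    by (simp add: laplacian_form)
  then show ?thesis by (simp add: tangent_def inner_vec_def)
qed

lemma theta_linear: "theta (a + b) i j = theta a i j + theta b i j" "theta (c *\<^sub>R a) i j = c * theta a i j"
  by (simp_all add: theta_def field_simps)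

lemma bilinear_laplacian: "bilinear (\<lambda>a \<Phi>. L a *v \<Phi>)"
  unfolding bilinear_def
proof (intro conjI allI)
  show "linear (\<lambda>a. L a *v \<Phi>)" for \<Phi>
    by (rule linearI) (auto simp: vec_eq_iff laplacian_nth theta_linear sum_distrib_left algebra_simps
        sum.distrib sum_subtractf)
qed simp

lemmas laplacian_simps =
  bilinear_ladd[OF bilinear_laplacian] bilinear_lsub[OF bilinear_laplacian]
  bilinear_lmul[OF bilinear_laplacian] bilinear_lneg[OF bilinear_laplacian]
  bilinear_radd[OF bilinear_laplacian] bilinear_rsub[OF bilinear_laplacian]
  bilinear_rmul[OF bilinear_laplacian] bilinear_rneg[OF bilinear_laplacian]

text \<open>The quadratic form is a sum of nonnegative terms, so its vanishing forces \<open>v\<close> to agree across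
  every edge; connectedness does the rest.\<close>

lemma laplacian_kernel:
  assumes \<rho>: "\<rho> \<in> simplex_int" and ker: "L \<rho> *v v = 0"
  shows "v $ i = v $ j"
proof -
  let ?c = "\<lambda>i j. \<omega> i j * theta \<rho> i j * (v $ i - v $ j) * (v $ i - v $ j)"
  have \<theta>: "theta \<rho> i j > 0" for i j
    using \<rho> by (simp add: simplex_int_def theta_def add_pos_pos)
  have nonneg: "?c i j \<ge> 0" for i j
    using weight_nonneg[of i j] \<theta>[of i j] by (simp add: mult.assoc)
  have "(\<Sum>i\<in>UNIV. \<Sum>j\<in>UNIV. ?c i j) = 0"
    using ker laplacian_form[of v \<rho> v] by simp
  then have "?c i j = 0" for i j
    using nonneg by (simp add: sum_nonneg_eq_0_iff sum_nonneg)
  then have edge: "v $ i = v $ j" if "(i, j) \<in> E" for i j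
    using \<theta>[of i j] weight_pos[OF that] by (metis less_irrefl mult_eq_0_iff right_minus_eq)
  show ?thesis
    using connected[of i j] by induction (auto dest: edge)
qed

text \<open>Adding the projection \<open>J\<close> onto constants makes \<open>L(\<rho>)\<close> invertible, and
  \<open>(L(\<rho>) + J)\<^sup>-\<^sup>1 - J\<close> satisfies the four Penrose conditions.  The products with \<open>L(\<rho>)\<close>
  are projections that do not depend on \<open>\<rho>\<close>, which is what makes the pseudo-inverse differentiable
  in \<open>\<rho>\<close>.\<close>

lemma laplacian_pinv:
  assumes \<rho>: "\<rho> \<in> simplex_int"
  shows "L \<rho> ** Ld \<rho> = mat 1 - mean_matrix" "Ld \<rho> ** L \<rho> = mat 1 - mean_matrix"
    "mean_matrix ** Ld \<rho> = 0" "Ld \<rho> ** mean_matrix = 0" "transpose (Ld \<rho>) = Ld \<rho>"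
proof -
  let ?L = "L \<rho>" and ?J = "mean_matrix :: real ^ 'n ^ 'n"
  define M where "M = ?L + ?J"
  have symL: "transpose ?L = ?L"
    using laplacian_symmetric by (simp add: symmetric_matrix_iff)
  have symJ: "transpose ?J = ?J"
    by (simp add: transpose_def mean_matrix_def vec_eq_iff)
  have JL: "?J ** ?L = 0"
    by (simp add: matrix_eq mean_matrix_tangent laplacian_tangent flip: matrix_vector_mul_assoc)
  have LJ: "?L ** ?J = 0"
    using arg_cong[OF JL, of transpose] by (simp add: matrix_transpose_mul symL symJ)
      (simp add: transpose_def vec_eq_iff)
  have JJ: "?J ** ?J = ?J"
    by (simp add: matrix_matrix_mult_def mean_matrix_def vec_eq_iff)
  have "v = 0" if "M *v v = 0" for v
  proof -
    have eq: "?L *v v + ?J *v v = 0"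
      using that by (simp add: M_def matrix_vector_mult_add_rdistrib)
    then have "?J *v (?L *v v + ?J *v v) = 0"
      by simp
    then have J: "?J *v v = 0"
      by (simp add: matrix_vector_right_distrib matrix_vector_mul_assoc JL JJ)
    with eq have "v $ i = v $ j" for i j
      using laplacian_kernel[OF \<rho>] by simp
    then have const: "v $ i = v $ undefined" for i
      by blast
    have "(\<Sum>j\<in>UNIV. v $ j) = (\<Sum>j\<in>(UNIV :: 'n set). v $ undefined)"
      by (rule sum.cong[OF refl const])
    then have "(\<Sum>j\<in>UNIV. v $ j) = real CARD('n) * v $ undefined"
      by simp
    moreover have "(\<Sum>j\<in>UNIV. v $ j) = 0"
      using mean_matrix_mult_vec[of v undefined] J by simp
    ultimately show "v = 0"
      using const by (metis mult_eq_0_iff of_nat_eq_0_iff vec_eq_iff zero_index zero_less_card_finite less_irrefl)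
  qed
  then obtain N where NM: "N ** M = mat 1"
    by (metis matrix_left_invertible_ker)
  then have MN: "M ** N = mat 1"
    by (simp add: matrix_left_right_inverse)
  have symM: "transpose M = M"
    by (simp add: M_def transpose_add symL symJ)
  have "N = transpose N"
    using arg_cong[OF MN, of transpose] NM symM
    by (metis matrix_mul_assoc matrix_mul_lid matrix_mul_rid matrix_transpose_mul MN transpose_mat)
  have JM: "?J ** M = ?J" and MJ: "M ** ?J = ?J"
    by (simp_all add: M_def matrix_add_ldistrib matrix_add_mult_distrib JL LJ JJ)
  have JN: "?J ** N = ?J"
    by (metis JM MN matrix_mul_assoc matrix_mul_rid)
  have NJ: "N ** ?J = ?J"
    by (metis MJ NM matrix_mul_assoc matrix_mul_lid)
  define P where "P = N - ?J"
  have L: "?L = M - ?J" by (simp add: M_def)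
  have LP: "?L ** P = mat 1 - ?J" and PL: "P ** ?L = mat 1 - ?J"
    unfolding L P_def by (simp_all add: matrix_sub_mult_distrib matrix_mult_sub_distrib MN NM JN NJ MJ JM JJ)
  have JP: "?J ** P = 0" and PJ: "P ** ?J = 0"
    unfolding P_def by (simp_all add: matrix_sub_mult_distrib matrix_mult_sub_distrib JN NJ JJ)
  have "is_pinv ?L P"
    unfolding is_pinv_def LP PL
    by (simp add: matrix_sub_mult_distrib JL JP transpose_diff symJ)
  then have P: "Ld \<rho> = P" by (rule pinv_eqI)
  show "L \<rho> ** Ld \<rho> = mat 1 - mean_matrix" "Ld \<rho> ** L \<rho> = mat 1 - mean_matrix"
    "mean_matrix ** Ld \<rho> = 0" "Ld \<rho> ** mean_matrix = 0"
    unfolding P by (rule LP PL JP PJ)+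
  show "transpose (Ld \<rho>) = Ld \<rho>"
    unfolding P using \<open>N = transpose N\<close> by (simp add: P_def transpose_diff symJ)
qed

lemma pinv_symmetric: "\<rho> \<in> simplex_int \<Longrightarrow> u \<bullet> (Ld \<rho> *v v) = v \<bullet> (Ld \<rho> *v u)"
  using laplacian_pinv(5) symmetric_matrix_iff by blast

lemma laplacian_pinv_tangent:
  "\<rho> \<in> simplex_int \<Longrightarrow> v \<in> tangent \<Longrightarrow> L \<rho> *v (Ld \<rho> *v v) = v"
  by (simp add: matrix_vector_mul_assoc laplacian_pinv matrix_vector_mult_diff_rdistrib
      mean_matrix_tangent)

lemma pinv_laplacian:
  "\<rho> \<in> simplex_int \<Longrightarrow> mean_matrix *v v = 0 \<Longrightarrow> Ld \<rho> *v (L \<rho> *v v) = v"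
  by (simp add: matrix_vector_mul_assoc laplacian_pinv matrix_vector_mult_diff_rdistrib)

lemma mean_pinv: "\<rho> \<in> simplex_int \<Longrightarrow> mean_matrix *v (Ld \<rho> *v v) = 0"
  by (simp add: matrix_vector_mul_assoc laplacian_pinv)

lemma pinv_laplacian_pinv:
  assumes "\<rho> \<in> simplex_int" "\<rho>' \<in> simplex_int"
  shows "Ld \<rho> *v (L \<rho>' *v (Ld \<rho>' *v v)) = Ld \<rho> *v v"
proof -
  have "Ld \<rho> *v (L \<rho>' *v (Ld \<rho>' *v v)) = Ld \<rho> *v (v - mean_matrix *v v)"
    using assms(2) by (simp add: matrix_vector_mul_assoc laplacian_pinv matrix_vector_mult_diff_rdistrib
        flip: matrix_mul_assoc)
  also have "\<dots> = Ld \<rho> *v v"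
    using assms(1) by (simp add: matrix_vector_mult_diff_distrib matrix_vector_mul_assoc laplacian_pinv)
  finally show ?thesis .
qed

text \<open>The analogue of \<open>M'\<^sup>-\<^sup>1 - M\<^sup>-\<^sup>1 = - M'\<^sup>-\<^sup>1 (M' - M) M\<^sup>-\<^sup>1\<close>; it holds because all the
  Laplacians involved have the same kernel and range.\<close>

lemma pinv_resolvent:
  assumes "\<rho> \<in> simplex_int" "\<rho>' \<in> simplex_int"
  shows "Ld \<rho>' *v v - Ld \<rho> *v v = - (Ld \<rho>' *v (L (\<rho>' - \<rho>) *v (Ld \<rho> *v v)))"
proof -
  have "Ld \<rho>' *v (L (\<rho>' - \<rho>) *v (Ld \<rho> *v v))
      = Ld \<rho>' *v (L \<rho>' *v (Ld \<rho> *v v)) - Ld \<rho>' *v (L \<rho> *v (Ld \<rho> *v v))"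
    by (simp add: laplacian_simps matrix_vector_mult_diff_distrib)
  also have "\<dots> = Ld \<rho> *v v - Ld \<rho>' *v v"
    using assms by (simp add: pinv_laplacian mean_pinv pinv_laplacian_pinv)
  finally show ?thesis by simp
qed

text \<open>The resolvent identity bounds the difference by a small multiple of the norm of the unknown vector
  \<open>Ld (\<rho> + t \<sigma>) v\<close>; for \<open>2 K \<bar>t\<bar> < 1\<close> this bootstraps to a bound by \<open>2 \<parallel>Ld \<rho> v\<parallel>\<close>.\<close>

lemma pinv_tendsto:
  assumes \<rho>: "\<rho> \<in> simplex_int" and \<sigma>: "\<sigma> \<in> tangent"
  shows "((\<lambda>t. Ld (\<rho> + t *\<^sub>R \<sigma>) *v v) \<longlongrightarrow> Ld \<rho> *v v) (at 0)"
proof -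
  let ?r = "\<lambda>t. \<rho> + t *\<^sub>R \<sigma>"
  obtain K where K: "K > 0" "\<And>x. norm (Ld \<rho> *v (L \<sigma> *v x)) \<le> norm x * K"
    using bounded_linear.pos_bounded[OF matrix_vector_mul_bounded_linear[of "Ld \<rho> ** L \<sigma>"]]
    by (auto simp: matrix_vector_mul_assoc)
  define C where "C = 2 * K * norm (Ld \<rho> *v v)"
  have "\<forall>\<^sub>F t in at 0. norm (Ld (?r t) *v v - Ld \<rho> *v v) \<le> \<bar>t\<bar> * C"
  proof -
    have "\<forall>\<^sub>F t in at 0. ?r t \<in> simplex_int"
      using eventually_simplex[OF \<rho> \<sigma>] by (simp add: eventually_nhds_conv_at)
    moreover have "\<forall>\<^sub>F t in at (0::real). \<bar>t\<bar> < 1 / (2 * K)"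
      using K unfolding eventually_at by (auto intro!: exI[of _ "1 / (2 * K)"])
    ultimately show ?thesis
    proof eventually_elim
      case (elim t)
      have "Ld \<rho> *v v - Ld (?r t) *v v = t *\<^sub>R (Ld \<rho> *v (L \<sigma> *v (Ld (?r t) *v v)))"
        using pinv_resolvent[OF elim(1) \<rho>, of v]
        by (simp add: laplacian_simps matrix_vector_mult_scaleR linear_neg)
      then have d: "norm (Ld (?r t) *v v - Ld \<rho> *v v) \<le> \<bar>t\<bar> * (norm (Ld (?r t) *v v) * K)"
        using K(2)[of "Ld (?r t) *v v"] by (metis abs_ge_zero mult_left_mono norm_minus_commute norm_scaleR)
      also have "\<dots> \<le> 1 / (2 * K) * (norm (Ld (?r t) *v v) * K)"
        using elim(2) K(1) by (intro mult_right_mono) auto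
      also have "\<dots> = norm (Ld (?r t) *v v) / 2"
        using K(1) by simp
      finally have "norm (Ld (?r t) *v v) \<le> 2 * norm (Ld \<rho> *v v)"
        using norm_triangle_sub[of "Ld (?r t) *v v" "Ld \<rho> *v v"] by simp
      then have "\<bar>t\<bar> * (norm (Ld (?r t) *v v) * K) \<le> \<bar>t\<bar> * C"
        using K(1) unfolding C_def by (intro mult_left_mono) auto
      with d show ?case by simp
    qed
  qed
  moreover have "((\<lambda>t::real. \<bar>t\<bar> * C) \<longlongrightarrow> 0) (at 0)"
    by (auto intro!: tendsto_eq_intros)
  ultimately have "((\<lambda>t. Ld (?r t) *v v - Ld \<rho> *v v) \<longlongrightarrow> 0) (at 0)"
    by (rule Lim_null_comparison)
  then show ?thesis
    by (rule LIM_zero_cancel)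
qed

text \<open>By the resolvent identity the difference quotient is
  \<open>- Ld (\<rho> + t \<sigma>) L(\<sigma>) Ld \<rho> v\<close>, so only continuity remains to be used.\<close>

lemma pinv_has_derivative:
  assumes \<rho>: "\<rho> \<in> simplex_int" and \<sigma>: "\<sigma> \<in> tangent"
  shows "((\<lambda>t. Ld (\<rho> + t *\<^sub>R \<sigma>) *v v) has_vector_derivative - (Ld \<rho> *v (L \<sigma> *v (Ld \<rho> *v v)))) (at 0)"
proof -
  let ?r = "\<lambda>t. \<rho> + t *\<^sub>R \<sigma>" and ?w = "L \<sigma> *v (Ld \<rho> *v v)"
  let ?q = "\<lambda>t. norm (Ld (?r t) *v v - Ld (?r 0) *v v - (t - 0) *\<^sub>R - (Ld \<rho> *v ?w)) / norm (t - 0)"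
  have "((\<lambda>t. norm (Ld (?r t) *v ?w - Ld \<rho> *v ?w)) \<longlongrightarrow> 0) (at 0)"
    using pinv_tendsto[OF \<rho> \<sigma>] by (intro tendsto_norm_zero LIM_zero)
  moreover have "\<forall>\<^sub>F t in at 0. norm (Ld (?r t) *v ?w - Ld \<rho> *v ?w) = ?q t"
  proof -
    have "\<forall>\<^sub>F t in at 0. ?r t \<in> simplex_int"
      using eventually_simplex[OF \<rho> \<sigma>] by (simp add: eventually_nhds_conv_at)
    moreover have "\<forall>\<^sub>F t in at (0::real). t \<noteq> 0"
      by (simp add: eventually_at_filter)
    ultimately show ?thesis
    proof eventually_elim
      case (elim t)
      have "Ld (?r t) *v v - Ld \<rho> *v v = - (t *\<^sub>R (Ld (?r t) *v ?w))"
        using pinv_resolvent[OF \<rho> elim(1), of v]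
        by (simp add: laplacian_simps matrix_vector_mult_scaleR)
      then have "Ld (?r t) *v v - Ld (?r 0) *v v - (t - 0) *\<^sub>R - (Ld \<rho> *v ?w)
          = (- t) *\<^sub>R (Ld (?r t) *v ?w - Ld \<rho> *v ?w)"
        by (simp add: scaleR_diff_right)
      then show ?case
        using elim(2) by simp
    qed
  qed
  ultimately have "(?q \<longlongrightarrow> 0) (at 0)"
    by (rule Lim_transform_eventually)
  then show ?thesis
    unfolding has_vector_derivative_def has_derivative_iff_norm
    by (simp add: bounded_linear_minus bounded_linear_scaleR_left)
qed

lemma bounded_bilinear_laplacian: "bounded_bilinear (\<lambda>a \<Phi>. L a *v \<Phi>)"
  using bilinear_laplacian by (simp add: bilinear_conv_bounded_bilinear)

text \<open>The pseudo-inverse is only known to be differentiable when applied to a fixed vector; expanding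
  the field in coordinates reduces to that case.\<close>

lemma pinv_field_has_dir_deriv:
  assumes \<rho>: "\<rho> \<in> simplex_int" and \<sigma>: "\<sigma> \<in> tangent" and X: "has_dir_deriv X X' \<rho> \<sigma>"
  shows "has_dir_deriv (\<lambda>x. Ld x *v X x) (Ld \<rho> *v X' - Ld \<rho> *v (L \<sigma> *v (Ld \<rho> *v X \<rho>))) \<rho> \<sigma>"
proof -
  have expand: "A *v v = (\<Sum>i\<in>UNIV. v $ i *\<^sub>R (A *v axis i 1))" for A :: "real ^ 'n ^ 'n" and v
  proof -
    have "A *v v = A *v (\<Sum>i\<in>UNIV. v $ i *\<^sub>R axis i 1)"
      using basis_expansion[of v] by (simp add: scalar_mult_eq_scaleR)
    then show ?thesis
      by (simp add: linear_sum matrix_vector_mult_scaleR)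
  qed
  let ?e = "\<lambda>i. axis i 1 :: real ^ 'n"
  have "((\<lambda>t. \<Sum>i\<in>UNIV. X (\<rho> + t *\<^sub>R \<sigma>) $ i *\<^sub>R (Ld (\<rho> + t *\<^sub>R \<sigma>) *v ?e i)) has_vector_derivative
      (\<Sum>i\<in>UNIV. X \<rho> $ i *\<^sub>R - (Ld \<rho> *v (L \<sigma> *v (Ld \<rho> *v ?e i))) + X' $ i *\<^sub>R (Ld \<rho> *v ?e i))) (at 0)"
  proof (rule has_vector_derivative_sum)
    fix i
    have a: "((\<lambda>t. X (\<rho> + t *\<^sub>R \<sigma>) $ i) has_real_derivative X' $ i) (at 0)"
      using X unfolding has_dir_deriv_def has_real_derivative_iff_has_vector_derivative
      by (rule bounded_linear.has_vector_derivative[OF bounded_linear_vec_nth])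
    show "((\<lambda>t. X (\<rho> + t *\<^sub>R \<sigma>) $ i *\<^sub>R (Ld (\<rho> + t *\<^sub>R \<sigma>) *v ?e i)) has_vector_derivative
        X \<rho> $ i *\<^sub>R - (Ld \<rho> *v (L \<sigma> *v (Ld \<rho> *v ?e i))) + X' $ i *\<^sub>R (Ld \<rho> *v ?e i)) (at 0)"
      using has_vector_derivative_scaleR[OF a pinv_has_derivative[OF \<rho> \<sigma>]] by simp
  qed
  moreover have "(\<Sum>i\<in>UNIV. X \<rho> $ i *\<^sub>R - (Ld \<rho> *v (L \<sigma> *v (Ld \<rho> *v ?e i))) + X' $ i *\<^sub>R (Ld \<rho> *v ?e i))
      = Ld \<rho> *v X' - Ld \<rho> *v (L \<sigma> *v (Ld \<rho> *v X \<rho>))"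
    using expand[of "Ld \<rho> ** L \<sigma> ** Ld \<rho>" "X \<rho>"] expand[of "Ld \<rho>" X']
    by (simp add: sum.distrib sum_negf sum_subtractf flip: matrix_vector_mul_assoc)
  ultimately show ?thesis
    unfolding has_dir_deriv_def by (simp add: expand[symmetric])
qed

section \<open>Christoffel symbols of the Wasserstein metric\<close>

abbreviation g :: "real ^ 'n \<Rightarrow> real ^ 'n \<Rightarrow> real ^ 'n \<Rightarrow> real" where "g \<equiv> metric_W E \<omega>"

definition K :: "real ^ 'n \<Rightarrow> real ^ 'n \<Rightarrow> real ^ 'n \<Rightarrow> real ^ 'n" where
  "K \<rho> v w = L v *v (Ld \<rho> *v w)"

text \<open>The dual of \<open>d \<mapsto> - (\<partial>\<^sub>d g)(a, b)\<close> with respect to \<open>g\<close>; see \<open>g_Q\<close>.\<close>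

definition Q :: "real ^ 'n \<Rightarrow> real ^ 'n \<Rightarrow> real ^ 'n \<Rightarrow> real ^ 'n" where
  "Q \<rho> a b = L \<rho> *v edge_prod E (grad \<omega> (Ld \<rho> *v a)) (grad \<omega> (Ld \<rho> *v b))"

text \<open>Christoffel symbols of the second kind, and below those of the first kind: half of
  \<open>\<partial>\<^sub>a g(b, d) + \<partial>\<^sub>b g(a, d) - \<partial>\<^sub>d g(a, b)\<close>, where \<open>\<partial>\<^sub>\<sigma> g(u, v) = - g(u, K \<sigma> v)\<close>.\<close>

definition \<Gamma> :: "real ^ 'n \<Rightarrow> real ^ 'n \<Rightarrow> real ^ 'n \<Rightarrow> real ^ 'n" where
  "\<Gamma> \<rho> a b = (1 / 2) *\<^sub>R (Q \<rho> a b - K \<rho> a b - K \<rho> b a)"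

definition \<Gamma>1 :: "real ^ 'n \<Rightarrow> real ^ 'n \<Rightarrow> real ^ 'n \<Rightarrow> real ^ 'n \<Rightarrow> real" where
  "\<Gamma>1 \<rho> a b d = (g \<rho> a (K \<rho> d b) - g \<rho> b (K \<rho> a d) - g \<rho> a (K \<rho> b d)) / 2"

lemma K_simps:
  "K \<rho> (a + b) w = K \<rho> a w + K \<rho> b w" "K \<rho> (a - b) w = K \<rho> a w - K \<rho> b w"
  "K \<rho> (c *\<^sub>R a) w = c *\<^sub>R K \<rho> a w" "K \<rho> (- a) w = - K \<rho> a w"
  "K \<rho> v (a + b) = K \<rho> v a + K \<rho> v b" "K \<rho> v (a - b) = K \<rho> v a - K \<rho> v b"
  "K \<rho> v (c *\<^sub>R a) = c *\<^sub>R K \<rho> v a" "K \<rho> v (- a) = - K \<rho> v a"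
  by (simp_all add: K_def laplacian_simps matrix_vector_right_distrib
      matrix_vector_mult_diff_distrib matrix_vector_mult_scaleR linear_neg)

lemma g_simps:
  "g \<rho> (a + b) w = g \<rho> a w + g \<rho> b w" "g \<rho> (a - b) w = g \<rho> a w - g \<rho> b w"
  "g \<rho> (c *\<^sub>R a) w = c * g \<rho> a w" "g \<rho> (- a) w = - g \<rho> a w"
  "g \<rho> v (a + b) = g \<rho> v a + g \<rho> v b" "g \<rho> v (a - b) = g \<rho> v a - g \<rho> v b"
  "g \<rho> v (c *\<^sub>R a) = c * g \<rho> v a" "g \<rho> v (- a) = - g \<rho> v a"
  by (simp_all add: metric_W_def matrix_vector_right_distrib matrix_vector_mult_diff_distrib
      matrix_vector_mult_scaleR linear_neg inner_simps)

lemma \<Gamma>1_add: "\<Gamma>1 \<rho> a (b + b') d = \<Gamma>1 \<rho> a b d + \<Gamma>1 \<rho> a b' d"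
  and \<Gamma>1_diff: "\<Gamma>1 \<rho> (a - a') b d = \<Gamma>1 \<rho> a b d - \<Gamma>1 \<rho> a' b d"
  by (simp_all add: \<Gamma>1_def K_simps g_simps field_simps)

lemma g_commute: "\<rho> \<in> simplex_int \<Longrightarrow> g \<rho> u v = g \<rho> v u"
  unfolding metric_W_def by (rule pinv_symmetric)

text \<open>\<open>g(u, K v w)\<close> is the symmetric form of \<open>L(v)\<close> evaluated at the potentials of \<open>u\<close> and \<open>w\<close>.\<close>

lemma g_K_commute:
  assumes \<rho>: "\<rho> \<in> simplex_int"
  shows "g \<rho> u (K \<rho> v w) = g \<rho> w (K \<rho> v u)"
proof -
  have "g \<rho> u (K \<rho> v w) = (Ld \<rho> *v u) \<bullet> (L v *v (Ld \<rho> *v w))" for u w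
    unfolding metric_W_def K_def using pinv_symmetric[OF \<rho>] by (metis inner_commute)
  then show ?thesis
    using laplacian_symmetric by simp
qed

lemma K_tangent: "K \<rho> v w \<in> tangent"
  and Q_tangent: "Q \<rho> a b \<in> tangent"
  by (simp_all add: K_def Q_def laplacian_tangent)

lemma \<Gamma>_tangent: "\<Gamma> \<rho> a b \<in> tangent"
  by (simp add: \<Gamma>_def K_tangent Q_tangent tangent_closed)

lemma Q_commute: "Q \<rho> a b = Q \<rho> b a"
  by (simp add: Q_def edge_prod_commute)

lemma g_Q:
  assumes \<rho>: "\<rho> \<in> simplex_int" and d: "d \<in> tangent"
  shows "g \<rho> (Q \<rho> a b) d = g \<rho> a (K \<rho> d b)"
proof -
  let ?e = "edge_prod E (grad \<omega> (Ld \<rho> *v a)) (grad \<omega> (Ld \<rho> *v b))"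
  have "g \<rho> (Q \<rho> a b) d = ?e \<bullet> (L \<rho> *v (Ld \<rho> *v d))"
    using laplacian_symmetric[of "Ld \<rho> *v d" \<rho> ?e] by (simp add: metric_W_def Q_def inner_commute)
  also have "\<dots> = d \<bullet> ?e"
    using \<rho> d by (simp add: laplacian_pinv_tangent inner_commute)
  also have "\<dots> = (Ld \<rho> *v a) \<bullet> (L d *v (Ld \<rho> *v b))"
    by (simp add: laplacian_form_edge_prod)
  also have "\<dots> = g \<rho> a (K \<rho> d b)"
    using pinv_symmetric[OF \<rho>, of a "L d *v (Ld \<rho> *v b)"] by (simp add: metric_W_def K_def inner_commute)
  finally show ?thesis .
qed

lemma g_\<Gamma>:
  assumes "\<rho> \<in> simplex_int" "d \<in> tangent"
  shows "g \<rho> (\<Gamma> \<rho> a b) d = \<Gamma>1 \<rho> a b d"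
  using assms g_K_commute[of \<rho> d a b] g_K_commute[of \<rho> d b a]
  by (simp add: \<Gamma>_def \<Gamma>1_def g_simps g_Q g_commute[of \<rho> _ d])

text \<open>\<open>B\<close> inverts \<open>L(\<rho>)\<close> on mean-zero vectors, so the test vector \<open>d = L(\<rho>) w\<close> returns \<open>w \<bullet> w\<close>.\<close>

lemma g_nondegenerate:
  assumes \<rho>: "\<rho> \<in> simplex_int" and t: "u \<in> tangent" "v \<in> tangent"
    and eq: "\<And>d. d \<in> tangent \<Longrightarrow> g \<rho> u d = g \<rho> v d"
  shows "u = v"
proof -
  define w where "w = u - v"
  have w: "w \<in> tangent" using t by (simp add: w_def tangent_closed)
  have "w \<bullet> w = (Ld \<rho> *v w) \<bullet> (L \<rho> *v w)"
    using laplacian_symmetric[of "Ld \<rho> *v w" \<rho> w] laplacian_pinv_tangent[OF \<rho> w] by simp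
  also have "\<dots> = g \<rho> w (L \<rho> *v w)"
    using pinv_symmetric[OF \<rho>, of w "L \<rho> *v w"] by (simp add: metric_W_def inner_commute)
  also have "\<dots> = 0"
    using eq[OF laplacian_tangent] by (simp add: w_def g_simps)
  finally show ?thesis by (simp add: w_def)
qed

lemma g_has_dir_deriv:
  assumes \<rho>: "\<rho> \<in> simplex_int" and \<sigma>: "\<sigma> \<in> tangent"
    and Y: "has_dir_deriv Y Y' \<rho> \<sigma>" and Z: "has_dir_deriv Z Z' \<rho> \<sigma>"
  shows "has_dir_deriv (\<lambda>x. g x (Y x) (Z x))
    (g \<rho> Y' (Z \<rho>) + g \<rho> (Y \<rho>) Z' - g \<rho> (Y \<rho>) (K \<rho> \<sigma> (Z \<rho>))) \<rho> \<sigma>"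
  using bounded_bilinear.has_vector_derivative[OF bounded_bilinear_inner
      Y[unfolded has_dir_deriv_def] pinv_field_has_dir_deriv[OF \<rho> \<sigma> Z, unfolded has_dir_deriv_def]]
  unfolding has_dir_deriv_def
  by (simp add: metric_W_def K_def inner_diff_right add.commute add_diff_eq)

lemma K_has_dir_deriv:
  assumes \<rho>: "\<rho> \<in> simplex_int" and \<sigma>: "\<sigma> \<in> tangent"
    and Y: "has_dir_deriv Y Y' \<rho> \<sigma>" and Z: "has_dir_deriv Z Z' \<rho> \<sigma>"
  shows "has_dir_deriv (\<lambda>x. K x (Y x) (Z x))
    (K \<rho> Y' (Z \<rho>) + K \<rho> (Y \<rho>) Z' - K \<rho> (Y \<rho>) (K \<rho> \<sigma> (Z \<rho>))) \<rho> \<sigma>"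
  using bounded_bilinear.has_vector_derivative[OF bounded_bilinear_laplacian
      Y[unfolded has_dir_deriv_def] pinv_field_has_dir_deriv[OF \<rho> \<sigma> Z, unfolded has_dir_deriv_def]]
  unfolding has_dir_deriv_def
  by (simp add: K_def laplacian_simps add.commute add_diff_eq)

text \<open>The two negative terms come from differentiating the pseudo-inverse on either side of \<open>L(Y)\<close>.  They
  are written with \<open>K\<close> on both slots of \<open>g\<close>, the shape in which they enter the curvature.\<close>

lemma g_K_has_dir_deriv:
  assumes \<rho>: "\<rho> \<in> simplex_int" and \<sigma>: "\<sigma> \<in> tangent"
    and X: "has_dir_deriv X X' \<rho> \<sigma>" and Y: "has_dir_deriv Y Y' \<rho> \<sigma>" and Z: "has_dir_deriv Z Z' \<rho> \<sigma>"
  shows "has_dir_deriv (\<lambda>x. g x (X x) (K x (Y x) (Z x)))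
    (g \<rho> X' (K \<rho> (Y \<rho>) (Z \<rho>)) + g \<rho> (X \<rho>) (K \<rho> Y' (Z \<rho>)) + g \<rho> (X \<rho>) (K \<rho> (Y \<rho>) Z')
      - g \<rho> (K \<rho> (Y \<rho>) (X \<rho>)) (K \<rho> \<sigma> (Z \<rho>)) - g \<rho> (K \<rho> \<sigma> (X \<rho>)) (K \<rho> (Y \<rho>) (Z \<rho>))) \<rho> \<sigma>"
proof -
  have "g \<rho> u (K \<rho> v (K \<rho> w z)) = g \<rho> (K \<rho> v u) (K \<rho> w z)" for u v w z
    using g_K_commute[OF \<rho>, of u v "K \<rho> w z"] g_commute[OF \<rho>] by metis
  then show ?thesis
    using g_has_dir_deriv[OF \<rho> \<sigma> X K_has_dir_deriv[OF \<rho> \<sigma> Y Z]]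
    by (simp add: g_simps algebra_simps)
qed

text \<open>The derivative of \<open>\<Gamma>1 \<rho> b c d\<close> in the base point \<open>\<rho>\<close> along \<open>\<sigma>\<close>, with \<open>b\<close>, \<open>c\<close>, \<open>d\<close> held fixed.\<close>

definition partial_\<Gamma>1 :: "real ^ 'n \<Rightarrow> real ^ 'n \<Rightarrow> real ^ 'n \<Rightarrow> real ^ 'n \<Rightarrow> real ^ 'n \<Rightarrow> real" where
  "partial_\<Gamma>1 \<rho> \<sigma> b c d =
    (- g \<rho> (K \<rho> d b) (K \<rho> \<sigma> c) - g \<rho> (K \<rho> \<sigma> b) (K \<rho> d c)
     + g \<rho> (K \<rho> b c) (K \<rho> \<sigma> d) + g \<rho> (K \<rho> \<sigma> c) (K \<rho> b d)
     + g \<rho> (K \<rho> c b) (K \<rho> \<sigma> d) + g \<rho> (K \<rho> \<sigma> b) (K \<rho> c d)) / 2"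

lemma has_dir_deriv_const: "has_dir_deriv (\<lambda>_. c) 0 \<rho> \<sigma>"
  by (simp add: has_dir_deriv_def)

lemma \<Gamma>1_has_dir_deriv:
  assumes \<rho>: "\<rho> \<in> simplex_int" and \<sigma>: "\<sigma> \<in> tangent"
    and Y: "has_dir_deriv Y Y' \<rho> \<sigma>" and Z: "has_dir_deriv Z Z' \<rho> \<sigma>"
  shows "has_dir_deriv (\<lambda>x. \<Gamma>1 x (Y x) (Z x) d)
    (\<Gamma>1 \<rho> Y' (Z \<rho>) d + \<Gamma>1 \<rho> (Y \<rho>) Z' d + partial_\<Gamma>1 \<rho> \<sigma> (Y \<rho>) (Z \<rho>) d) \<rho> \<sigma>"
proof -
  note c = has_dir_deriv_const[of d \<rho> \<sigma>]
  note parts = g_K_has_dir_deriv[OF \<rho> \<sigma> Y c Z] g_K_has_dir_deriv[OF \<rho> \<sigma> Z Y c]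
    g_K_has_dir_deriv[OF \<rho> \<sigma> Y Z c]
  have zero: "K \<rho> 0 v = 0" "K \<rho> v 0 = 0" "g \<rho> v 0 = 0" for v
    by (simp_all add: K_def metric_W_def)
      (metis scale_zero_left bilinear_lmul[OF bilinear_laplacian])
  have "has_dir_deriv (\<lambda>x. (g x (Y x) (K x d (Z x)) - g x (Z x) (K x (Y x) d) - g x (Y x) (K x (Z x) d)) / 2)
     (((g \<rho> Y' (K \<rho> d (Z \<rho>)) + g \<rho> (Y \<rho>) (K \<rho> 0 (Z \<rho>)) + g \<rho> (Y \<rho>) (K \<rho> d Z')
      - g \<rho> (K \<rho> d (Y \<rho>)) (K \<rho> \<sigma> (Z \<rho>)) - g \<rho> (K \<rho> \<sigma> (Y \<rho>)) (K \<rho> d (Z \<rho>)))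
      - (g \<rho> Z' (K \<rho> (Y \<rho>) d) + g \<rho> (Z \<rho>) (K \<rho> Y' d) + g \<rho> (Z \<rho>) (K \<rho> (Y \<rho>) 0)
      - g \<rho> (K \<rho> (Y \<rho>) (Z \<rho>)) (K \<rho> \<sigma> d) - g \<rho> (K \<rho> \<sigma> (Z \<rho>)) (K \<rho> (Y \<rho>) d))
      - (g \<rho> Y' (K \<rho> (Z \<rho>) d) + g \<rho> (Y \<rho>) (K \<rho> Z' d) + g \<rho> (Y \<rho>) (K \<rho> (Z \<rho>) 0)
      - g \<rho> (K \<rho> (Z \<rho>) (Y \<rho>)) (K \<rho> \<sigma> d) - g \<rho> (K \<rho> \<sigma> (Y \<rho>)) (K \<rho> (Z \<rho>) d))) / 2) \<rho> \<sigma>"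
    unfolding has_dir_deriv_def
    by (intro bounded_linear.has_vector_derivative[OF bounded_linear_divide]
        has_vector_derivative_diff parts[unfolded has_dir_deriv_def])
  then show ?thesis
    by (simp add: \<Gamma>1_def partial_\<Gamma>1_def zero add_divide_distrib diff_divide_distrib algebra_simps)
qed

section \<open>Levi-Civita connection and curvature\<close>

context
  fixes D :: "'n connection"
  assumes LC: "levi_civita g D"
begin

lemma connection_field: "X \<in> vector_fields \<Longrightarrow> Y \<in> vector_fields \<Longrightarrow> D X Y \<in> vector_fields"
  using LC by (simp add: levi_civita_def affine_connection_def)

lemma connection_torsion:
  "X \<in> vector_fields \<Longrightarrow> Y \<in> vector_fields \<Longrightarrow> \<rho> \<in> simplex_int
    \<Longrightarrow> D X Y \<rho> - D Y X \<rho> = lie_bracket X Y \<rho>"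
  using LC by (simp add: levi_civita_def torsion_free_def)

lemma connection_metric:
  "X \<in> vector_fields \<Longrightarrow> Y \<in> vector_fields \<Longrightarrow> Z \<in> vector_fields \<Longrightarrow> \<rho> \<in> simplex_int
    \<Longrightarrow> dir_deriv (\<lambda>x. g x (Y x) (Z x)) \<rho> (X \<rho>) = g \<rho> (D X Y \<rho>) (Z \<rho>) + g \<rho> (Y \<rho>) (D X Z \<rho>)"
  using LC by (simp add: levi_civita_def metric_compatible_def)

text \<open>Smoothness comes from the vanishing torsion: on the simplex the bracket is the difference of the
  smooth fields \<open>\<nabla>\<^sub>X Y\<close> and \<open>\<nabla>\<^sub>Y X\<close>.\<close>

lemma lie_bracket_field:
  fixes X Y :: "real ^ 'n \<Rightarrow> real ^ 'n"
  assumes "X \<in> vector_fields" "Y \<in> vector_fields"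
  shows "lie_bracket X Y \<in> vector_fields"
proof -
  have "D X Y \<in> vector_fields" "D Y X \<in> vector_fields"
    using assms connection_field by auto
  then have "Ck k (\<lambda>x. D X Y x - D Y X x)" for k
    by (auto intro: Ck_diff simp: vector_fields_def smooth_def)
  then have "Ck k (lie_bracket X Y)" for k
    by (rule Ck_cong[rotated]) (use connection_torsion assms in auto)
  moreover have "lie_bracket X Y x \<in> tangent" if "x \<in> simplex_int" for x
    using assms that by (auto simp: lie_bracket_def vector_fields_def
        intro!: tangent_closed dir_deriv_tangent[unfolded vector_fields_def])
  ultimately show ?thesis
    by (simp add: vector_fields_def smooth_def)
qed

lemma field_has_dir_deriv:
  "X \<in> vector_fields \<Longrightarrow> \<rho> \<in> simplex_int \<Longrightarrow> \<sigma> \<in> tangent \<Longrightarrow> has_dir_deriv X (dir_deriv X \<rho> \<sigma>) \<rho> \<sigma>"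
  by (simp add: vector_fields_def has_dir_deriv_dir_deriv smooth_imp_differentiable)

lemma field_tangent: "X \<in> vector_fields \<Longrightarrow> \<rho> \<in> simplex_int \<Longrightarrow> X \<rho> \<in> tangent"
  by (simp add: vector_fields_def)

text \<open>Koszul's argument with one constant field: add the derivatives of \<open>g(Y, d)\<close> along \<open>X\<close> and of
  \<open>g(X, d)\<close> along \<open>Y\<close>, subtract that of \<open>g(X, Y)\<close> along \<open>d\<close>, and remove all covariant derivatives
  but \<open>\<nabla>\<^sub>X Y\<close> with the torsion identities.\<close>

lemma koszul:
  assumes X: "X \<in> vector_fields" and Y: "Y \<in> vector_fields" and d: "d \<in> tangent"
    and \<rho>: "\<rho> \<in> simplex_int"
  shows "g \<rho> (D X Y \<rho>) d = g \<rho> (dir_deriv Y \<rho> (X \<rho>)) d + \<Gamma>1 \<rho> (X \<rho>) (Y \<rho>) d"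
proof -
  let ?d = "\<lambda>_ :: real ^ 'n. d"
  note f = X Y const_vector_field[OF d]
  note t = field_tangent[OF X \<rho>] field_tangent[OF Y \<rho>]
  have zero: "g \<rho> 0 v = 0" "g \<rho> v 0 = 0" for v
    by (simp_all add: metric_W_def)
  have m1: "g \<rho> (D X Y \<rho>) d + g \<rho> (Y \<rho>) (D X ?d \<rho>)
      = g \<rho> (dir_deriv Y \<rho> (X \<rho>)) d - g \<rho> (Y \<rho>) (K \<rho> (X \<rho>) d)"
    using connection_metric[OF f(1,2,3) \<rho>] has_dir_deriv_imp_eq[OF g_has_dir_deriv[OF \<rho> t(1)
          field_has_dir_deriv[OF Y \<rho> t(1)] has_dir_deriv_const[of d]]] by (simp add: zero)
  have m2: "g \<rho> (D Y ?d \<rho>) (X \<rho>) + g \<rho> d (D Y X \<rho>)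
      = g \<rho> d (dir_deriv X \<rho> (Y \<rho>)) - g \<rho> d (K \<rho> (Y \<rho>) (X \<rho>))"
    using connection_metric[OF f(2,3,1) \<rho>] has_dir_deriv_imp_eq[OF g_has_dir_deriv[OF \<rho> t(2)
          has_dir_deriv_const[of d] field_has_dir_deriv[OF X \<rho> t(2)]]] by (simp add: zero)
  have m3: "g \<rho> (D ?d X \<rho>) (Y \<rho>) + g \<rho> (X \<rho>) (D ?d Y \<rho>)
      = g \<rho> (dir_deriv X \<rho> d) (Y \<rho>) + g \<rho> (X \<rho>) (dir_deriv Y \<rho> d) - g \<rho> (X \<rho>) (K \<rho> d (Y \<rho>))"
    using connection_metric[OF f(3,1,2) \<rho>] has_dir_deriv_imp_eq[OF g_has_dir_deriv[OF \<rho> d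
          field_has_dir_deriv[OF X \<rho> d] field_has_dir_deriv[OF Y \<rho> d]]] by simp
  have t1: "g \<rho> d (D X Y \<rho>) - g \<rho> d (D Y X \<rho>)
      = g \<rho> d (dir_deriv Y \<rho> (X \<rho>)) - g \<rho> d (dir_deriv X \<rho> (Y \<rho>))"
    using connection_torsion[OF f(1,2) \<rho>] by (simp add: lie_bracket_def flip: g_simps(6))
  have t2: "g \<rho> (Y \<rho>) (D X ?d \<rho>) - g \<rho> (Y \<rho>) (D ?d X \<rho>) = - g \<rho> (Y \<rho>) (dir_deriv X \<rho> d)"
    using connection_torsion[OF f(1,3) \<rho>] by (simp add: lie_bracket_def dir_deriv_const flip: g_simps(6,8))
  have t3: "g \<rho> (X \<rho>) (D Y ?d \<rho>) - g \<rho> (X \<rho>) (D ?d Y \<rho>) = - g \<rho> (X \<rho>) (dir_deriv Y \<rho> d)"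
    using connection_torsion[OF f(2,3) \<rho>] by (simp add: lie_bracket_def dir_deriv_const flip: g_simps(6,8))
  have "g \<rho> (D X Y \<rho>) d + g \<rho> (D Y X \<rho>) d
      = g \<rho> (dir_deriv Y \<rho> (X \<rho>)) d + g \<rho> (dir_deriv X \<rho> (Y \<rho>)) d
        - g \<rho> (Y \<rho>) (K \<rho> (X \<rho>) d) - g \<rho> (X \<rho>) (K \<rho> (Y \<rho>) d) + g \<rho> (X \<rho>) (K \<rho> d (Y \<rho>))"
    using m1 m2 m3 t2 t3 g_K_commute[OF \<rho>, of d "Y \<rho>" "X \<rho>"]
    unfolding g_commute[OF \<rho>, of d] g_commute[OF \<rho>, of "D Y ?d \<rho>"]
      g_commute[OF \<rho>, of "D ?d X \<rho>"] g_commute[OF \<rho>, of "dir_deriv X \<rho> d"]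
    by simp
  then show ?thesis
    using t1 unfolding \<Gamma>1_def g_commute[OF \<rho>, of d] by argo
qed

lemma connection_eq:
  assumes X: "X \<in> vector_fields" and Y: "Y \<in> vector_fields" and \<rho>: "\<rho> \<in> simplex_int"
  shows "D X Y \<rho> = dir_deriv Y \<rho> (X \<rho>) + \<Gamma> \<rho> (X \<rho>) (Y \<rho>)"
proof (rule g_nondegenerate[OF \<rho>])
  show "D X Y \<rho> \<in> tangent"
    by (rule field_tangent[OF connection_field[OF X Y] \<rho>])
  show "dir_deriv Y \<rho> (X \<rho>) + \<Gamma> \<rho> (X \<rho>) (Y \<rho>) \<in> tangent"
    by (intro tangent_closed dir_deriv_tangent[OF Y \<rho>] field_tangent[OF X \<rho>] \<Gamma>_tangent)
  show "g \<rho> (D X Y \<rho>) d = g \<rho> (dir_deriv Y \<rho> (X \<rho>) + \<Gamma> \<rho> (X \<rho>) (Y \<rho>)) d" if "d \<in> tangent" for d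
    using koszul[OF X Y that \<rho>] g_\<Gamma>[OF \<rho> that] by (simp add: g_simps)
qed

text \<open>Differentiate \<open>g(\<nabla>\<^sub>Y Z, d)\<close> along \<open>X\<close> in two ways, by the product rule for the field \<open>\<nabla>\<^sub>Y Z\<close> and
  from Koszul's formula.  This needs only Christoffel symbols of the first kind to be differentiated.
  The terms quadratic in Christoffel symbols combine to \<open>- \<Gamma>1 (X, d, \<Gamma>(Y, Z))\<close>.\<close>

lemma second_covariant_derivative:
  assumes X: "X \<in> vector_fields" and Y: "Y \<in> vector_fields" and Z: "Z \<in> vector_fields"
    and d: "d \<in> tangent" and \<rho>: "\<rho> \<in> simplex_int"
  shows "g \<rho> (D X (D Y Z) \<rho>) d =
    g \<rho> (dir_deriv (\<lambda>x. dir_deriv Z x (Y x)) \<rho> (X \<rho>)) d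
    + \<Gamma>1 \<rho> (dir_deriv Y \<rho> (X \<rho>)) (Z \<rho>) d
    + \<Gamma>1 \<rho> (Y \<rho>) (dir_deriv Z \<rho> (X \<rho>)) d + \<Gamma>1 \<rho> (X \<rho>) (dir_deriv Z \<rho> (Y \<rho>)) d
    + partial_\<Gamma>1 \<rho> (X \<rho>) (Y \<rho>) (Z \<rho>) d - g \<rho> (\<Gamma> \<rho> (X \<rho>) d) (\<Gamma> \<rho> (Y \<rho>) (Z \<rho>))"
proof -
  let ?a = "X \<rho>" and ?U = "D Y Z" and ?V = "\<lambda>x. dir_deriv Z x (Y x)"
  let ?G = "\<Gamma> \<rho> (Y \<rho>) (Z \<rho>)"
  have U: "?U \<in> vector_fields" by (rule connection_field[OF Y Z])
  have a: "?a \<in> tangent" by (rule field_tangent[OF X \<rho>])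
  have V: "has_dir_deriv ?V (dir_deriv ?V \<rho> ?a) \<rho> ?a"
    using has_dir_deriv_along_field[OF _ Y \<rho> a, of Z] Z has_dir_deriv_imp_eq
    by (fastforce simp: vector_fields_def)
  have zero: "g \<rho> v 0 = 0" for v
    by (simp add: metric_W_def)
  have 1: "has_dir_deriv (\<lambda>x. g x (?U x) d)
      (g \<rho> (dir_deriv ?U \<rho> ?a) d - g \<rho> (?U \<rho>) (K \<rho> ?a d)) \<rho> ?a"
    using g_has_dir_deriv[OF \<rho> a field_has_dir_deriv[OF U \<rho> a] has_dir_deriv_const[of d]]
    by (simp add: zero)
  have "has_dir_deriv (\<lambda>x. g x (?V x) d)
      (g \<rho> (dir_deriv ?V \<rho> ?a) d - g \<rho> (?V \<rho>) (K \<rho> ?a d)) \<rho> ?a"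
    using g_has_dir_deriv[OF \<rho> a V has_dir_deriv_const[of d]] by (simp add: zero)
  from has_vector_derivative_add[OF this[unfolded has_dir_deriv_def]
      \<Gamma>1_has_dir_deriv[OF \<rho> a field_has_dir_deriv[OF Y \<rho> a] field_has_dir_deriv[OF Z \<rho> a],
        of d, unfolded has_dir_deriv_def]]
  have 2: "has_dir_deriv (\<lambda>x. g x (?V x) d + \<Gamma>1 x (Y x) (Z x) d)
      (g \<rho> (dir_deriv ?V \<rho> ?a) d - g \<rho> (?V \<rho>) (K \<rho> ?a d)
        + (\<Gamma>1 \<rho> (dir_deriv Y \<rho> ?a) (Z \<rho>) d + \<Gamma>1 \<rho> (Y \<rho>) (dir_deriv Z \<rho> ?a) d
            + partial_\<Gamma>1 \<rho> ?a (Y \<rho>) (Z \<rho>) d)) \<rho> ?a"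
    unfolding has_dir_deriv_def .
  have 3: "has_dir_deriv (\<lambda>x. g x (?U x) d)
      (g \<rho> (dir_deriv ?V \<rho> ?a) d - g \<rho> (?V \<rho>) (K \<rho> ?a d)
        + (\<Gamma>1 \<rho> (dir_deriv Y \<rho> ?a) (Z \<rho>) d + \<Gamma>1 \<rho> (Y \<rho>) (dir_deriv Z \<rho> ?a) d
            + partial_\<Gamma>1 \<rho> ?a (Y \<rho>) (Z \<rho>) d)) \<rho> ?a"
    by (rule has_dir_deriv_cong[OF \<rho> a _ 2]) (simp add: koszul[OF Y Z d])
  have Ueq: "?U \<rho> = ?V \<rho> + ?G"
    by (rule connection_eq[OF Y Z \<rho>])
  have "g \<rho> (D X ?U \<rho>) d = g \<rho> (dir_deriv ?U \<rho> ?a) d + \<Gamma>1 \<rho> ?a (?V \<rho>) d + \<Gamma>1 \<rho> ?a ?G d"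
    using koszul[OF X U d \<rho>] by (simp add: Ueq \<Gamma>1_add)
  moreover have "\<Gamma>1 \<rho> ?a ?G d + g \<rho> ?G (K \<rho> ?a d) = - \<Gamma>1 \<rho> ?a d ?G"
    using g_K_commute[OF \<rho>, of d ?a ?G] by (simp add: \<Gamma>1_def field_simps)
  moreover have "\<Gamma>1 \<rho> ?a d ?G = g \<rho> (\<Gamma> \<rho> ?a d) ?G"
    by (rule g_\<Gamma>[OF \<rho> \<Gamma>_tangent, symmetric])
  ultimately show ?thesis
    using has_dir_deriv_unique[OF 1 3] by (simp add: Ueq g_simps)
qed

text \<open>Antisymmetrising the second covariant derivative in \<open>X\<close> and \<open>Y\<close>, all terms with derivatives of the
  fields cancel: the mixed ones are symmetric, and those with flat second derivatives of \<open>Z\<close> or with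
  \<open>\<partial>\<^sub>X Y - \<partial>\<^sub>Y X\<close> are matched by \<open>\<nabla>\<close> along \<open>[X, Y]\<close>.\<close>

lemma curvature_christoffel:
  assumes X: "X \<in> vector_fields" and Y: "Y \<in> vector_fields" and Z: "Z \<in> vector_fields"
    and d: "d \<in> tangent" and \<rho>: "\<rho> \<in> simplex_int"
  shows "g \<rho> (curvature D X Y Z \<rho>) d =
    partial_\<Gamma>1 \<rho> (X \<rho>) (Y \<rho>) (Z \<rho>) d - partial_\<Gamma>1 \<rho> (Y \<rho>) (X \<rho>) (Z \<rho>) d
    - g \<rho> (\<Gamma> \<rho> (X \<rho>) d) (\<Gamma> \<rho> (Y \<rho>) (Z \<rho>)) + g \<rho> (\<Gamma> \<rho> (Y \<rho>) d) (\<Gamma> \<rho> (X \<rho>) (Z \<rho>))"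
proof -
  have Zs: "smooth Z" using Z by (simp add: vector_fields_def)
  have "g \<rho> (curvature D X Y Z \<rho>) d
      = g \<rho> (D X (D Y Z) \<rho>) d - g \<rho> (D Y (D X Z) \<rho>) d - g \<rho> (D (lie_bracket X Y) Z \<rho>) d"
    by (simp add: curvature_def g_simps)
  moreover have "g \<rho> (D (lie_bracket X Y) Z \<rho>) d
      = g \<rho> (dir_deriv (\<lambda>x. dir_deriv Z x (Y x)) \<rho> (X \<rho>)) d
        - g \<rho> (dir_deriv (\<lambda>x. dir_deriv Z x (X x)) \<rho> (Y \<rho>)) d
        + \<Gamma>1 \<rho> (dir_deriv Y \<rho> (X \<rho>)) (Z \<rho>) d - \<Gamma>1 \<rho> (dir_deriv X \<rho> (Y \<rho>)) (Z \<rho>) d"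
    unfolding koszul[OF lie_bracket_field[OF X Y] Z d \<rho>] dir_deriv_commutator[OF Zs X Y \<rho>, symmetric]
    by (simp add: g_simps lie_bracket_def \<Gamma>1_diff)
  ultimately show ?thesis
    using second_covariant_derivative[OF X Y Z d \<rho>] second_covariant_derivative[OF Y X Z d \<rho>]
    by simp
qed

end

section \<open>The curvature formula\<close>

lemma m_op_eq: "m_op E \<omega> \<rho> a b = - (K \<rho> a b + K \<rho> b a) + (1 / 2) *\<^sub>R Q \<rho> a b"
  by (simp add: m_op_def K_def Q_def matrix_vector_mul_assoc)

lemma n_op_eq: "n_op E \<omega> \<rho> a b = K \<rho> a b - K \<rho> b a"
  by (simp add: n_op_def K_def matrix_vector_mul_assoc)

lemma m_op_tangent: "m_op E \<omega> \<rho> a b \<in> tangent"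
  by (simp add: m_op_eq K_tangent Q_tangent tangent_closed)

lemma n_op_tangent: "n_op E \<omega> \<rho> a b \<in> tangent"
  by (simp add: n_op_eq K_tangent tangent_closed)

text \<open>Since \<open>m\<close> is tangent, \<open>g(b, K (m a c) d) = g(Q b d, m a c)\<close>, so both sides are quadratic in the
  vectors \<open>K x y\<close> and \<open>Q x y\<close>.  The \<open>Q\<close>-terms agree one by one.  In the rest, \<open>\<Gamma>\<close> contributes symmetrised
  products of \<open>K\<close>'s, which differ from the products of \<open>n\<close>'s by exactly what the eight surviving
  terms of the derivatives leave after splitting off \<open>n(a, b) n(c, d)\<close>.\<close>

lemma christoffel_curvature_algebra:
  assumes \<rho>: "\<rho> \<in> simplex_int"
  shows "partial_\<Gamma>1 \<rho> a b c d - partial_\<Gamma>1 \<rho> b a c d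
      - g \<rho> (\<Gamma> \<rho> a d) (\<Gamma> \<rho> b c) + g \<rho> (\<Gamma> \<rho> b d) (\<Gamma> \<rho> a c)
    = 1 / 4 * (g \<rho> b (K \<rho> (m_op E \<omega> \<rho> a c) d) + g \<rho> a (K \<rho> (m_op E \<omega> \<rho> b d) c)
        - g \<rho> b (K \<rho> (m_op E \<omega> \<rho> a d) c) - g \<rho> a (K \<rho> (m_op E \<omega> \<rho> b c) d)
        + 2 * g \<rho> (n_op E \<omega> \<rho> a b) (n_op E \<omega> \<rho> c d)
        + g \<rho> (n_op E \<omega> \<rho> a c) (n_op E \<omega> \<rho> b d)
        - g \<rho> (n_op E \<omega> \<rho> b c) (n_op E \<omega> \<rho> a d))"
  unfolding g_Q[OF \<rho> m_op_tangent, symmetric]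
  unfolding partial_\<Gamma>1_def \<Gamma>_def m_op_eq n_op_eq
  by (simp add: g_simps g_commute[OF \<rho>] field_simps)

end

theorem proposition6:
  fixes E :: "('n::finite \<times> 'n) set"
    and \<omega> :: "'n \<Rightarrow> 'n \<Rightarrow> real"
    and D :: "'n connection"
    and \<rho> \<sigma>\<^sub>1 \<sigma>\<^sub>2 \<sigma>\<^sub>3 \<sigma>\<^sub>4 :: "real ^ 'n"
    and X\<^sub>1 X\<^sub>2 X\<^sub>3 :: "real ^ 'n \<Rightarrow> real ^ 'n"
  assumes graph: "connected_weighted_graph E \<omega>"
    and LC: "levi_civita (metric_W E \<omega>) D"
    and rho: "\<rho> \<in> simplex_int"
    and sigma: "\<sigma>\<^sub>1 \<in> tangent" "\<sigma>\<^sub>2 \<in> tangent" "\<sigma>\<^sub>3 \<in> tangent" "\<sigma>\<^sub>4 \<in> tangent"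
    and fields: "X\<^sub>1 \<in> vector_fields" "X\<^sub>2 \<in> vector_fields" "X\<^sub>3 \<in> vector_fields"
    and extend: "X\<^sub>1 \<rho> = \<sigma>\<^sub>1" "X\<^sub>2 \<rho> = \<sigma>\<^sub>2" "X\<^sub>3 \<rho> = \<sigma>\<^sub>3"
  shows "let L = laplacian E \<omega>;
             Ld = pinv (laplacian E \<omega> \<rho>);
             m = m_op E \<omega> \<rho>;
             n = n_op E \<omega> \<rho>
         in metric_W E \<omega> \<rho> (curvature D X\<^sub>1 X\<^sub>2 X\<^sub>3 \<rho>) \<sigma>\<^sub>4 =
              1 / 4 *
               (\<sigma>\<^sub>2 \<bullet> ((Ld ** L (m \<sigma>\<^sub>1 \<sigma>\<^sub>3) ** Ld) *v \<sigma>\<^sub>4)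
                + \<sigma>\<^sub>1 \<bullet> ((Ld ** L (m \<sigma>\<^sub>2 \<sigma>\<^sub>4) ** Ld) *v \<sigma>\<^sub>3)
                - \<sigma>\<^sub>2 \<bullet> ((Ld ** L (m \<sigma>\<^sub>1 \<sigma>\<^sub>4) ** Ld) *v \<sigma>\<^sub>3)
                - \<sigma>\<^sub>1 \<bullet> ((Ld ** L (m \<sigma>\<^sub>2 \<sigma>\<^sub>3) ** Ld) *v \<sigma>\<^sub>4)
                + 2 * (n \<sigma>\<^sub>1 \<sigma>\<^sub>2 \<bullet> (Ld *v n \<sigma>\<^sub>3 \<sigma>\<^sub>4))
                + n \<sigma>\<^sub>1 \<sigma>\<^sub>3 \<bullet> (Ld *v n \<sigma>\<^sub>2 \<sigma>\<^sub>4)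
                - n \<sigma>\<^sub>2 \<sigma>\<^sub>3 \<bullet> (Ld *v n \<sigma>\<^sub>1 \<sigma>\<^sub>4))
          \<and> (\<forall>a\<in>tangent. \<forall>b\<in>tangent. m a b \<in> tangent \<and> m a b = m b a)
          \<and> (\<forall>a\<in>tangent. \<forall>b\<in>tangent. n a b \<in> tangent \<and> n a b = - n b a)"
proof -
  interpret weighted_graph E \<omega>
    by unfold_locales (rule graph)
  have T: "u \<bullet> ((Ld \<rho> ** L x ** Ld \<rho>) *v v) = g \<rho> u (K \<rho> x v)" for u v x
    by (simp add: metric_W_def K_def matrix_vector_mul_assoc matrix_mul_assoc)
  have G: "u \<bullet> (Ld \<rho> *v v) = g \<rho> u v" for u v
    by (simp add: metric_W_def)
  have "m_op E \<omega> \<rho> a b = m_op E \<omega> \<rho> b a" "n_op E \<omega> \<rho> a b = - n_op E \<omega> \<rho> b a" for a b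
    by (simp_all add: m_op_eq n_op_eq Q_commute add.commute)
  then show ?thesis
    unfolding Let_def T G curvature_christoffel[OF LC fields sigma(4) rho] extend
      christoffel_curvature_algebra[OF rho]
    using m_op_tangent n_op_tangent by blast
qed

end
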